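(* Let $\mathcal M,\tilde{\mathcal M}\in\mathfrak B_1(\Omega)$ be isomorphic via a unitary module map, and let $w_0\in\Omega$. Then the corresponding holomorphic Hermitian vector bundles $\mathcal P_0$ (of $\mathcal M$) and $\tilde{\mathcal P}_0$ (of $\tilde{\mathcal M}$) on $\Omega_0^*$ are equivalent.
   Context: $\Omega\subset\mathbb C^m$ is a bounded domain and $\mathfrak m_w\subset\mathbb C[\underline z]=\mathbb C[z_1,\dots,z_m]$ is the maximal ideal of polynomials vanishing at $w$. A Hilbert module over $\mathbb C[\underline z]$ is a Hilbert space with a $\mathbb C[\underline z]$-module structure in which every polynomial acts as a bounded operator. The class $\mathfrak B_1(\Omega)$ consists of the Hilbert modules $\mathcal M$ over $\mathbb C[\underline z]$ whose elements are holomorphic functions on $\Omega$, with module action given by pointwise multiplication, such that (rk) $\mathcal M$ has a reproducing kernel $K$ (the value $K(w,w)=0$ is allowed), and (fin) $\dim\mathcal M/\mathfrak m_w\mathcal M<\infty$ for all $w\in\Omega$, where $\mathfrak m_w\mathcal M=\{\sum_{j=1}^m(z_j-w_j)f_j:f_j\in\mathcal M\}$. For $\mathcal M\in\mathfrak B_1(\Omega)$ let $M_j$ be multiplication by $z_j$ and let $D_{(\mathbf M-w)^*}:\mathcal M\to\mathcal M\oplus\cdots\oplus\mathcal M$ ($m$ summands) be $f\mapsto((M_j-w_j)^*f)_{j=1}^m$; its range is closed for $w\in\Omega$. Fix $w_0\in\Omega$. Let $\mathbb P_0$ be the orthogonal projection of $\mathcal M^{\oplus m}$ onto $\operatorname{ran}D_{(\mathbf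 M-w_0)^*}$, and let $R_{\mathbf M}(w_0):\mathcal M^{\oplus m}\to\mathcal M$ be the Moore–Penrose inverse of $D_{(\mathbf M-w_0)^*}$ (zero on the orthocomplement of $\operatorname{ran}D_{(\mathbf M-w_0)^*}$, and inverse to $D_{(\mathbf M-w_0)^*}:(\ker D_{(\mathbf M-w_0)^*})^\perp\to\operatorname{ran}D_{(\mathbf M-w_0)^*}$ on that range). Let $\Omega_0=\{w\in\Omega:\|w-w_0\|<\|R_{\mathbf M}(w_0)\|^{-1}\}$ (the same set for unitarily equivalent modules) and $\Omega_0^*=\{\bar w:w\in\Omega_0\}$. The bundle $\mathcal P_0$ is the Hermitian holomorphic vector bundle over $\Omega_0^*$, a subbundle of the trivial bundle with fibre $\mathcal M$ with the induced metric, whose fibre at $\bar w$ is $\ker\mathbb P_0D_{(\mathbf M-w)^*}$; these kernels have constant dimension and vary holomorphically in $\bar w\in\Omega_0^*$. The bundle $\tilde{\mathcal P}_0$ is constructed in the same way from $\tilde{\mathcal M}$ with the same point $w_0$. A unitary module map is a unitary operator intertwining the module actions. Two Hermitian holomorphic bundles over the same base are equivalent if there is a holomorphic bundle isomorphism over the identity map of the base that is isometric on fibres. *)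

theory Defs
  imports "HOL-Analysis.Analysis"
begin

section \<open>Complex Hilbert spaces\<close>

text \<open>The inner product is linear in the first argument. The underlying real inner product
  is its real part, so norm, topology and completeness are those of the library.\<close>

class complex_hilbert = real_inner + complete_space +
  fixes scaleC :: "complex \<Rightarrow> 'a \<Rightarrow> 'a"  (infixr \<open>*\<^sub>C\<close> 75)
    and cinner :: "'a \<Rightarrow> 'a \<Rightarrow> complex"
  assumes scaleC_add_right: "c *\<^sub>C (x + y) = c *\<^sub>C x + c *\<^sub>C y"
    and scaleC_add_left: "(c + d) *\<^sub>C x = c *\<^sub>C x + d *\<^sub>C x"
    and scaleC_scaleC: "c *\<^sub>C d *\<^sub>C x = (c * d) *\<^sub>C x"
    and scaleC_of_real: "complex_of_real r *\<^sub>C x = scaleR r x"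
    and cinner_commute: "cinner x y = cnj (cinner y x)"
    and cinner_add_left: "cinner (x + y) z = cinner x z + cinner y z"
    and cinner_scaleC_left: "cinner (c *\<^sub>C x) y = c * cinner x y"
    and Re_cinner: "Re (cinner x y) = inner x y"

global_interpretation complex_vector:
  vector_space "scaleC :: complex \<Rightarrow> 'a \<Rightarrow> 'a::complex_hilbert"
proof
  fix c d :: complex and x y :: 'a
  show "c *\<^sub>C (x + y) = c *\<^sub>C x + c *\<^sub>C y" by (rule scaleC_add_right)
  show "(c + d) *\<^sub>C x = c *\<^sub>C x + d *\<^sub>C x" by (rule scaleC_add_left)
  show "c *\<^sub>C d *\<^sub>C x = (c * d) *\<^sub>C x" by (rule scaleC_scaleC)
  show "1 *\<^sub>C x = x" using scaleC_of_real[of 1 x] by simp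
qed

instantiation complex :: complex_hilbert
begin
definition "c *\<^sub>C (x :: complex) = c * x"
definition "cinner (x :: complex) y = x * cnj y"
instance
  by standard (auto simp: scaleC_complex_def cinner_complex_def algebra_simps
      scaleR_conv_of_real inner_complex_def)
end

text \<open>The orthogonal direct sum of finitely many copies of a Hilbert space; in particular
  the Hilbert space \<open>complex ^ 'm\<close>.\<close>

instantiation vec :: (complex_hilbert, finite) complex_hilbert
begin
definition "c *\<^sub>C (x :: 'a ^ 'b) = (\<chi> i. c *\<^sub>C x $ i)"
definition "cinner (x :: 'a ^ 'b) y = (\<Sum>i\<in>UNIV. cinner (x $ i) (y $ i))"
instance
proof
  fix c d :: complex and r :: real and x y z :: "'a ^ 'b"
  show "c *\<^sub>C (x + y) = c *\<^sub>C x + c *\<^sub>C y"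
    and "(c + d) *\<^sub>C x = c *\<^sub>C x + d *\<^sub>C x"
    and "c *\<^sub>C d *\<^sub>C x = (c * d) *\<^sub>C x"
    and "complex_of_real r *\<^sub>C x = scaleR r x"
    by (simp_all add: vec_eq_iff scaleC_vec_def scaleC_add_right scaleC_add_left
        scaleC_scaleC scaleC_of_real)
  show "cinner x y = cnj (cinner y x)"
    unfolding cinner_vec_def cnj_sum by (rule sum.cong[OF refl cinner_commute])
  show "cinner (x + y) z = cinner x z + cinner y z"
    by (simp add: cinner_vec_def cinner_add_left sum.distrib)
  show "cinner (c *\<^sub>C x) y = c * cinner x y"
    by (simp add: cinner_vec_def scaleC_vec_def cinner_scaleC_left sum_distrib_left)
  show "Re (cinner x y) = inner x y"
    by (simp add: cinner_vec_def inner_vec_def Re_cinner)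
qed
end

abbreviation clinear :: "('a::complex_hilbert \<Rightarrow> 'b::complex_hilbert) \<Rightarrow> bool"
  where "clinear \<equiv> Vector_Spaces.linear scaleC scaleC"

definition orth :: "'a::complex_hilbert set \<Rightarrow> 'a set"
  where "orth S = {x. \<forall>s\<in>S. cinner x s = 0}"

definition orth_proj :: "'a::complex_hilbert set \<Rightarrow> 'a \<Rightarrow> 'a"
  where "orth_proj S x = (THE p. p \<in> S \<and> x - p \<in> orth S)"

definition hilbert_adjoint ::
    "('a::complex_hilbert \<Rightarrow> 'b::complex_hilbert) \<Rightarrow> 'b \<Rightarrow> 'a"
  where "hilbert_adjoint T = (THE S. \<forall>x y. cinner (T x) y = cinner x (S y))"

definition ker :: "('a \<Rightarrow> 'b::zero) \<Rightarrow> 'a set"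
  where "ker T = {x. T x = 0}"

definition moore_penrose ::
    "('a::complex_hilbert \<Rightarrow> 'b::complex_hilbert) \<Rightarrow> 'b \<Rightarrow> 'a"
  where "moore_penrose T =
    (THE R. clinear R \<and> (\<forall>y\<in>orth (range T). R y = 0) \<and> (\<forall>x\<in>orth (ker T). R (T x) = x))"

section \<open>Holomorphic functions and Hermitian holomorphic bundles\<close>

text \<open>Complex Frechet differentiability at every point; only used for open \<open>S\<close>.\<close>

definition holomorphic_fun_on ::
    "('a::complex_hilbert \<Rightarrow> 'b::complex_hilbert) \<Rightarrow> 'a set \<Rightarrow> bool"
  where "holomorphic_fun_on f S \<longleftrightarrow>
    (\<forall>x\<in>S. \<exists>D. clinear D \<and> (f has_derivative D) (at x))"

text \<open>Families of subspaces of \<open>'h\<close> over a base in \<open>'b\<close>: candidates for subbundles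
  of the trivial bundle with fibre \<open>'h\<close>. The metric is always the one induced by
  \<^const>\<open>cinner\<close>, so it is not part of the data.\<close>

record ('b, 'h) subbundle =
  base :: "'b set"
  fibre :: "'b \<Rightarrow> 'h set"

definition holomorphic_section ::
    "('b::complex_hilbert, 'h::complex_hilbert) subbundle \<Rightarrow> 'b set \<Rightarrow> ('b \<Rightarrow> 'h) \<Rightarrow> bool"
  where "holomorphic_section E V s \<longleftrightarrow> holomorphic_fun_on s V \<and> (\<forall>x\<in>V. s x \<in> fibre E x)"

definition holomorphic_frame ::
    "('b::complex_hilbert, 'h::complex_hilbert) subbundle \<Rightarrow> 'b set \<Rightarrow> nat
      \<Rightarrow> (nat \<Rightarrow> 'b \<Rightarrow> 'h) \<Rightarrow> bool"
  where "holomorphic_frame E V n s \<longleftrightarrow>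
    (\<forall>i<n. holomorphic_section E V (s i)) \<and>
    (\<forall>x\<in>V. inj_on (\<lambda>i. s i x) {..<n} \<and>
       complex_vector.independent ((\<lambda>i. s i x) ` {..<n}) \<and>
       complex_vector.span ((\<lambda>i. s i x) ` {..<n}) = fibre E x)"

definition hermitian_holomorphic_bundle ::
    "('b::complex_hilbert, 'h::complex_hilbert) subbundle \<Rightarrow> bool"
  where "hermitian_holomorphic_bundle E \<longleftrightarrow>
    open (base E) \<and>
    (\<exists>n. \<forall>x\<in>base E. \<exists>V s. open V \<and> x \<in> V \<and> V \<subseteq> base E \<and> holomorphic_frame E V n s)"

text \<open>A fibrewise linear map over the identity is holomorphic iff it takes local holomorphic
  sections to local holomorphic sections.\<close>

definition holomorphic_bundle_map ::
    "('b::complex_hilbert, 'h::complex_hilbert) subbundle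
      \<Rightarrow> ('b, 'k::complex_hilbert) subbundle \<Rightarrow> ('b \<Rightarrow> 'h \<Rightarrow> 'k) \<Rightarrow> bool"
  where "holomorphic_bundle_map E F \<Phi> \<longleftrightarrow>
    (\<forall>x\<in>base E. \<Phi> x ` fibre E x \<subseteq> fibre F x \<and>
       (\<forall>f\<in>fibre E x. \<forall>g\<in>fibre E x. \<forall>a b.
          \<Phi> x (a *\<^sub>C f + b *\<^sub>C g) = a *\<^sub>C \<Phi> x f + b *\<^sub>C \<Phi> x g)) \<and>
    (\<forall>V s. open V \<and> V \<subseteq> base E \<and> holomorphic_section E V s
       \<longrightarrow> holomorphic_section F V (\<lambda>x. \<Phi> x (s x)))"

definition equivalent_bundles ::
    "('b::complex_hilbert, 'h::complex_hilbert) subbundle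
      \<Rightarrow> ('b, 'k::complex_hilbert) subbundle \<Rightarrow> bool"
  where "equivalent_bundles E F \<longleftrightarrow>
    hermitian_holomorphic_bundle E \<and> hermitian_holomorphic_bundle F \<and> base E = base F \<and>
    (\<exists>\<Phi> \<Psi>. holomorphic_bundle_map E F \<Phi> \<and> holomorphic_bundle_map F E \<Psi> \<and>
       (\<forall>x\<in>base E. (\<forall>f\<in>fibre E x. \<Psi> x (\<Phi> x f) = f) \<and> (\<forall>g\<in>fibre F x. \<Phi> x (\<Psi> x g) = g) \<and>
          (\<forall>f\<in>fibre E x. \<forall>g\<in>fibre E x. cinner (\<Phi> x f) (\<Phi> x g) = cinner f g)))"

section \<open>Hilbert modules of holomorphic functions\<close>

text \<open>Polynomials in \<open>m\<close> complex variables, identified with polynomial functions.\<close>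

inductive poly_fun :: "(complex ^ 'm \<Rightarrow> complex) \<Rightarrow> bool"
  where
    const: "poly_fun (\<lambda>z. c)"
  | coord: "poly_fun (\<lambda>z. z $ j)"
  | add: "poly_fun p \<Longrightarrow> poly_fun q \<Longrightarrow> poly_fun (\<lambda>z. p z + q z)"
  | mult: "poly_fun p \<Longrightarrow> poly_fun q \<Longrightarrow> poly_fun (\<lambda>z. p z * q z)"

definition bounded_domain :: "(complex ^ 'm) set \<Rightarrow> bool"
  where "bounded_domain \<Omega> \<longleftrightarrow> open \<Omega> \<and> connected \<Omega> \<and> \<Omega> \<noteq> {} \<and> bounded \<Omega>"

text \<open>A Hilbert space whose elements are functions on \<open>\<Omega>\<close> is given by a Hilbert space type
  \<open>'h\<close> and the map \<open>ev\<close> that sends each element to the function it is: \<open>ev f z\<close> is the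
  value of \<open>f\<close> at \<open>z\<close>. Only values at points of \<open>\<Omega>\<close> are meaningful.\<close>

definition function_space ::
    "(complex ^ 'm) set \<Rightarrow> ('h::complex_hilbert \<Rightarrow> complex ^ 'm \<Rightarrow> complex) \<Rightarrow> bool"
  where "function_space \<Omega> ev \<longleftrightarrow>
    (\<forall>f g. \<forall>z\<in>\<Omega>. ev (f + g) z = ev f z + ev g z) \<and>
    (\<forall>c f. \<forall>z\<in>\<Omega>. ev (c *\<^sub>C f) z = c * ev f z) \<and>
    (\<forall>f g. (\<forall>z\<in>\<Omega>. ev f z = ev g z) \<longrightarrow> f = g)"

definition act ::
    "(complex ^ 'm) set \<Rightarrow> ('h \<Rightarrow> complex ^ 'm \<Rightarrow> complex)
      \<Rightarrow> (complex ^ 'm \<Rightarrow> complex) \<Rightarrow> 'h \<Rightarrow> 'h"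
  where "act \<Omega> ev p f = (THE g. \<forall>z\<in>\<Omega>. ev g z = p z * ev f z)"

definition maximal_ideal_module ::
    "(complex ^ 'm) set \<Rightarrow> ('h::complex_hilbert \<Rightarrow> complex ^ 'm \<Rightarrow> complex)
      \<Rightarrow> complex ^ 'm \<Rightarrow> 'h set"
  where "maximal_ideal_module \<Omega> ev w =
    {(\<Sum>j\<in>UNIV. act \<Omega> ev (\<lambda>z. z $ j - w $ j) (f j)) | f. True}"

definition has_reproducing_kernel ::
    "(complex ^ 'm) set \<Rightarrow> ('h::complex_hilbert \<Rightarrow> complex ^ 'm \<Rightarrow> complex) \<Rightarrow> bool"
  where "has_reproducing_kernel \<Omega> ev \<longleftrightarrow>
    (\<exists>K :: complex ^ 'm \<Rightarrow> complex ^ 'm \<Rightarrow> complex. \<forall>w\<in>\<Omega>. \<exists>k.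
       (\<forall>z\<in>\<Omega>. ev k z = K z w) \<and> (\<forall>f. ev f w = cinner f k))"

text \<open>The quotient by a subspace \<open>S\<close> is finite dimensional: finitely many cosets span it.\<close>

definition finite_codim :: "'h::complex_hilbert set \<Rightarrow> bool"
  where "finite_codim S \<longleftrightarrow> (\<exists>B. finite B \<and> complex_vector.span (B \<union> S) = UNIV)"

definition class_B1 ::
    "(complex ^ 'm) set \<Rightarrow> ('h::complex_hilbert \<Rightarrow> complex ^ 'm \<Rightarrow> complex) \<Rightarrow> bool"
  where "class_B1 \<Omega> ev \<longleftrightarrow>
    function_space \<Omega> ev \<and>
    (\<forall>f. holomorphic_fun_on (ev f) \<Omega>) \<and>
    (\<forall>p. poly_fun p \<longrightarrow> (\<forall>f. \<exists>g. \<forall>z\<in>\<Omega>. ev g z = p z * ev f z) \<and>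
       clinear (act \<Omega> ev p) \<and> bounded_linear (act \<Omega> ev p)) \<and>
    has_reproducing_kernel \<Omega> ev \<and>
    (\<forall>w\<in>\<Omega>. finite_codim (maximal_ideal_module \<Omega> ev w))"

definition unitary_module_map ::
    "(complex ^ 'm) set \<Rightarrow> ('h::complex_hilbert \<Rightarrow> complex ^ 'm \<Rightarrow> complex)
      \<Rightarrow> ('k::complex_hilbert \<Rightarrow> complex ^ 'm \<Rightarrow> complex) \<Rightarrow> ('h \<Rightarrow> 'k) \<Rightarrow> bool"
  where "unitary_module_map \<Omega> ev ev' U \<longleftrightarrow>
    clinear U \<and> surj U \<and> (\<forall>f g. cinner (U f) (U g) = cinner f g) \<and>
    (\<forall>p. poly_fun p \<longrightarrow> (\<forall>f. U (act \<Omega> ev p f) = act \<Omega> ev' p (U f)))"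

definition coord_mult ::
    "(complex ^ 'm) set \<Rightarrow> ('h \<Rightarrow> complex ^ 'm \<Rightarrow> complex) \<Rightarrow> 'm \<Rightarrow> 'h \<Rightarrow> 'h"
  where "coord_mult \<Omega> ev j = act \<Omega> ev (\<lambda>z. z $ j)"

definition D_adj ::
    "(complex ^ 'm) set \<Rightarrow> ('h::complex_hilbert \<Rightarrow> complex ^ 'm \<Rightarrow> complex)
      \<Rightarrow> complex ^ 'm \<Rightarrow> 'h \<Rightarrow> 'h ^ 'm"
  where "D_adj \<Omega> ev w f =
    (\<chi> j. hilbert_adjoint (\<lambda>g. coord_mult \<Omega> ev j g - (w $ j) *\<^sub>C g) f)"

text \<open>\<open>\<parallel>w - w\<^sub>0\<parallel> < \<parallel>R\<parallel>\<^sup>-\<^sup>1\<close> is written as a product, so that \<open>R = 0\<close>, which happens only for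
  the zero module, imposes no condition.\<close>

definition Omega0 ::
    "(complex ^ 'm) set \<Rightarrow> ('h::complex_hilbert \<Rightarrow> complex ^ 'm \<Rightarrow> complex)
      \<Rightarrow> complex ^ 'm \<Rightarrow> (complex ^ 'm) set"
  where "Omega0 \<Omega> ev w0 =
    {w \<in> \<Omega>. norm (w - w0) * onorm (moore_penrose (D_adj \<Omega> ev w0)) < 1}"

definition cnj_vec :: "complex ^ 'm \<Rightarrow> complex ^ 'm"
  where "cnj_vec w = (\<chi> j. cnj (w $ j))"

definition P0_bundle ::
    "(complex ^ 'm) set \<Rightarrow> ('h::complex_hilbert \<Rightarrow> complex ^ 'm \<Rightarrow> complex)
      \<Rightarrow> complex ^ 'm \<Rightarrow> (complex ^ 'm, 'h) subbundle"
  where "P0_bundle \<Omega> ev w0 =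
    \<lparr> base = cnj_vec ` Omega0 \<Omega> ev w0,
      fibre = (\<lambda>u. ker (\<lambda>f. orth_proj (range (D_adj \<Omega> ev w0)) (D_adj \<Omega> ev (cnj_vec u) f))) \<rparr>"

end

theory Submission
  imports Defs
begin

text \<open>
  Write \<open>D\<close> for the operator at \<open>w\<^sub>0\<close>, \<open>R\<close> for its Moore--Penrose inverse and
  \<open>\<iota>\<^sub>v f = (v\<^sub>j f)\<^sub>j\<close>. With \<open>v = cnj (w - w\<^sub>0)\<close>, the operator at \<open>w\<close> is \<open>D - \<iota>\<^sub>v\<close>, and the fibre at
  \<open>cnj w\<close> is \<open>{f. (I - R \<iota>\<^sub>v) f \<in> ker D}\<close>, that is, the image of the finite dimensional space \<open>ker D\<close>
  under the inverse of \<open>I - R \<iota>\<^sub>v\<close>, which exists and is holomorphic in \<open>v\<close> as long as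
  \<open>\<parallel>R\<parallel> \<parallel>v\<parallel> < 1\<close>; so a basis of \<open>ker D\<close> gives a global holomorphic frame. That \<open>R\<close> is bounded
  follows from (fin): by uniform boundedness \<open>D\<close> together with finitely many functionals is bounded
  below, and compactness removes the functionals on the complement of \<open>ker D\<close>.
  The fibre at \<open>cnj w\<close> also consists of the \<open>f\<close> with \<open>(D - \<iota>\<^sub>v) f\<close> orthogonal to the range of \<open>D\<close>.
  A unitary module map \<open>U\<close> preserves this condition and the norm of \<open>R\<close>, so \<open>U\<close> itself, acting
  fibrewise, is the required equivalence.
\<close>

section \<open>Inner products\<close>

lemma cinner_add_right: "cinner x (y + z) = cinner x y + cinner x z"
  by (metis cinner_add_left cinner_commute complex_cnj_add)

lemma cinner_scaleC_right: "cinner x (c *\<^sub>C y) = cnj c * cinner x y"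
  by (metis cinner_commute cinner_scaleC_left complex_cnj_mult)

lemma cinner_scaleR_left: "cinner (r *\<^sub>R x) y = of_real r * cinner x y"
  by (simp only: cinner_scaleC_left flip: scaleC_of_real)

lemma scaleC_minus_one: "(- 1) *\<^sub>C x = - (x::'a::complex_hilbert)"
  using scaleC_of_real[of "-1" x] by simp

lemma cinner_minus_left [simp]: "cinner (- x) y = - cinner x y"
  using cinner_scaleC_left[of "-1" x y] by (simp add: scaleC_minus_one)

lemma cinner_minus_right [simp]: "cinner x (- y) = - cinner x y"
  using cinner_scaleC_right[of x "-1" y] by (simp add: scaleC_minus_one)

lemma cinner_diff_left: "cinner (x - y) z = cinner x z - cinner y z"
  using cinner_add_left[of x "- y" z] by simp

lemma cinner_diff_right: "cinner x (y - z) = cinner x y - cinner x z"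
  using cinner_add_right[of x y "- z"] by simp

lemma cinner_zero_left [simp]: "cinner 0 y = 0"
  using cinner_diff_left[of 0 0 y] by simp

lemma cinner_zero_right [simp]: "cinner x 0 = 0"
  using cinner_diff_right[of x 0 0] by simp

lemma cinner_sum_left: "cinner (\<Sum>i\<in>I. f i) y = (\<Sum>i\<in>I. cinner (f i) y)"
  by (induction I rule: infinite_finite_induct) (auto simp: cinner_add_left)

lemma cinner_self: "cinner x x = of_real ((norm x)\<^sup>2)"
proof -
  have "Im (cinner x x) = 0"
    using arg_cong[OF cinner_commute[of x x], of Im] by simp
  then show ?thesis
    by (simp add: complex_eq_iff Re_cinner power2_norm_eq_inner)
qed

lemma cinner_self_eq_0 [simp]: "cinner x x = 0 \<longleftrightarrow> x = 0"
  by (simp add: cinner_self)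

lemma cinner_eqI:
  assumes "\<And>z. cinner z x = cinner z y"
  shows "x = y"
proof -
  have "cinner (x - y) (x - y) = 0" by (simp add: cinner_diff_right assms)
  then show ?thesis by simp
qed

lemma Im_cinner: "Im (cinner x y) = inner x (\<i> *\<^sub>C y)"
  by (simp flip: Re_cinner add: cinner_scaleC_right)

lemma norm_scaleC: "norm (c *\<^sub>C x) = cmod c * norm (x::'a::complex_hilbert)"
proof -
  have "complex_of_real ((norm (c *\<^sub>C x))\<^sup>2) = c * cnj c * of_real ((norm x)\<^sup>2)"
    by (simp only: cinner_self[symmetric] cinner_scaleC_left cinner_scaleC_right mult_ac)
  also have "\<dots> = of_real ((cmod c * norm x)\<^sup>2)"
    by (simp only: complex_norm_square[symmetric] power_mult_distrib of_real_mult)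
  finally have "(norm (c *\<^sub>C x))\<^sup>2 = (cmod c * norm x)\<^sup>2"
    by (simp only: of_real_eq_iff)
  then show ?thesis
    by simp
qed

lemma norm_cinner_le: "cmod (cinner x y) \<le> norm x * norm y"
proof (cases "cinner x y = 0")
  case False
  \<comment> \<open>A unit scalar that rotates \<open>cinner x y\<close> to its modulus, so that the
    real Cauchy-Schwarz inequality applies.\<close>
  define c where "c = cnj (sgn (cinner x y))"
  have c: "cmod c = 1" using False by (simp add: c_def norm_sgn)
  have "c * cinner x y = of_real (cmod (cinner x y))"
    using False complex_norm_square[of "cinner x y"]
    by (simp add: c_def sgn_eq field_simps power2_eq_square)
  then have "cmod (cinner x y) = inner (c *\<^sub>C x) y"
    by (simp flip: Re_cinner add: cinner_scaleC_left)
  also have "\<dots> \<le> norm (c *\<^sub>C x) * norm y" by (rule norm_cauchy_schwarz)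
  finally show ?thesis by (simp add: norm_scaleC c)
qed simp

lemma bounded_linear_cinner_left: "bounded_linear (\<lambda>x. cinner x (y::'a::complex_hilbert))"
proof (rule bounded_linear_intro[where K = "norm y"])
  show "cinner (r *\<^sub>R x) y = r *\<^sub>R cinner x y" for r x
    by (simp only: cinner_scaleC_left scaleR_conv_of_real flip: scaleC_of_real[of r x])
qed (auto simp: cinner_add_left norm_cinner_le)

text \<open>Norms multiply exactly, which is why the perturbation of the operator at
  \<open>w0\<close> is measured by the Euclidean distance between base points.\<close>

lemma norm_scaleC_vec: "norm (\<chi> j. v $ j *\<^sub>C f) = norm (v::complex ^ 'm) * norm (f::'a::complex_hilbert)"
  by (simp add: norm_vec_def norm_scaleC L2_set_left_distrib)

lemma clinearI:
  assumes "\<And>x y. f (x + y) = f x + f y" "\<And>c x. f (c *\<^sub>C x) = c *\<^sub>C f x"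
  shows "clinear f"
  by (unfold_locales) (auto simp: assms)

lemma clinear_add: "clinear f \<Longrightarrow> f (x + y) = f x + f y"
  and clinear_scaleC: "clinear f \<Longrightarrow> f (c *\<^sub>C x) = c *\<^sub>C f x"
  by (simp_all add: Vector_Spaces.linear_def module_hom_def module_hom_axioms_def)

lemma clinear_scaleR: "clinear f \<Longrightarrow> f (r *\<^sub>R x) = r *\<^sub>R f x"
  by (simp flip: scaleC_of_real add: clinear_scaleC)

lemma clinear_bounded:
  assumes "clinear f" "\<And>x. norm (f x) \<le> B * norm x"
  shows "bounded_linear f"
  by (rule bounded_linear_intro[where K = B])
    (use assms in \<open>auto simp: clinear_add clinear_scaleR mult.commute\<close>)

section \<open>Orthogonal projection and adjoint\<close>

text \<open>A minimizing sequence for the distance from \<open>x\<close> to \<open>S\<close> is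
  Cauchy by the parallelogram law, and completeness supplies a nearest point. Minimality along each
  line in \<open>S\<close> through that point forces orthogonality.\<close>

lemma real_projection_exists:
  fixes S :: "'a::{real_inner, complete_space} set"
  assumes S: "closed S" "subspace S"
  shows "\<exists>p\<in>S. \<forall>s\<in>S. inner (x - p) s = 0"
proof -
  define d where "d = infdist x S"
  have ne: "S \<noteq> {}" using S subspace_0 by blast
  have d: "d \<ge> 0" "\<And>y. y \<in> S \<Longrightarrow> d \<le> norm (x - y)"
    by (auto simp: d_def infdist_nonneg infdist_le dist_norm[symmetric])
  have "\<exists>y\<in>S. norm (x - y) < d + 1 / Suc n" for n
  proof (rule ccontr)
    assume "\<not> ?thesis"
    then have "d + 1 / Suc n \<le> infdist x S"
      by (subst infdist_notempty[OF ne]) (auto intro!: cINF_greatest[OF ne] simp: dist_norm)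
    then show False by (simp add: d_def)
  qed
  then obtain y where y: "\<And>n. y n \<in> S" "\<And>n. norm (x - y n) < d + 1 / Suc n" by metis
  have ysq: "(norm (x - y n))\<^sup>2 \<le> d\<^sup>2 + (2 * d + 1) / Suc n" for n
  proof -
    have "(norm (x - y n))\<^sup>2 \<le> (d + 1 / Suc n)\<^sup>2"
      using y(2)[of n] by (intro power_mono) auto
    also have "\<dots> = d\<^sup>2 + 2 * d * (1 / Suc n) + (1 / Suc n) * (1 / Suc n)"
      by (simp add: power2_eq_square algebra_simps)
    also have "(1 / real (Suc n)) * (1 / Suc n) \<le> 1 * (1 / Suc n)"
      by (intro mult_right_mono) auto
    finally show ?thesis by (simp add: add_divide_distrib)
  qed
  have par: "(norm (y n - y m))\<^sup>2 \<le> 2 * ((2 * d + 1) / Suc n) + 2 * ((2 * d + 1) / Suc m)" for n m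
  proof -
    \<comment> \<open>The midpoint stays in \<open>S\<close>, so its distance from \<open>x\<close>
      is at least \<open>d\<close>; near-minimality of \<open>y n\<close> and \<open>y m\<close>
      then makes them close.\<close>
    define z where "z = (1/2) *\<^sub>R (y n + y m)"
    have "z \<in> S" unfolding z_def using S y(1) by (intro subspace_scale subspace_add) auto
    then have "d\<^sup>2 \<le> (norm (x - z))\<^sup>2" using d by (intro power_mono) auto
    moreover have "(norm (y n - y m))\<^sup>2 + 4 * (norm (x - z))\<^sup>2
        = 2 * (norm (x - y n))\<^sup>2 + 2 * (norm (x - y m))\<^sup>2"
      by (simp add: z_def power2_norm_eq_inner inner_diff inner_add inner_commute algebra_simps)
    ultimately show ?thesis using ysq[of n] ysq[of m] by linarith
  qed
  have "Cauchy y"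
  proof (rule metric_CauchyI)
    fix e :: real assume e: "e > 0"
    \<comment> \<open>Past this threshold each of the two summands in \<open>par\<close> is below
      half of the square of \<open>e\<close>.\<close>
    define c where "c = 4 * (2 * d + 1) / e\<^sup>2"
    obtain N :: nat where N: "c < N" using reals_Archimedean2 by blast
    have "dist (y m) (y n) < e" if "m \<ge> N" "n \<ge> N" for m n
    proof -
      have *: "2 * ((2 * d + 1) / Suc k) < e\<^sup>2 / 2" if "k \<ge> N" for k
      proof -
        have "c < Suc k" using N that by linarith
        then show ?thesis using e by (simp add: c_def field_simps)
      qed
      have "(norm (y m - y n))\<^sup>2 < e\<^sup>2"
        using par[of m n] *[OF that(1)] *[OF that(2)] by linarith
      then show ?thesis using e by (simp add: dist_norm power_less_imp_less_base)
    qed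
    then show "\<exists>M. \<forall>m\<ge>M. \<forall>n\<ge>M. dist (y m) (y n) < e" by blast
  qed
  then obtain p where p: "y \<longlonglongrightarrow> p" using Cauchy_convergent_iff convergent_def by blast
  have pS: "p \<in> S" using S(1) y(1) p closed_sequentially by blast
  have "(\<lambda>n. norm (x - y n)) \<longlonglongrightarrow> norm (x - p)" by (intro tendsto_intros p)
  moreover have "(\<lambda>n. d + 1 / Suc n) \<longlonglongrightarrow> d + 0"
    by (intro tendsto_intros LIMSEQ_Suc[OF lim_1_over_n])
  ultimately have pd: "norm (x - p) \<le> d"
    using y(2) by (intro LIMSEQ_le[of _ _ "\<lambda>n. d + 1 / Suc n" d]) (auto intro: less_imp_le)
  have "inner (x - p) s = 0" if s: "s \<in> S" for s
  proof (cases "s = 0")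
    case False
    \<comment> \<open>The coefficient of the projection of \<open>x - p\<close> on \<open>s\<close>,
      which minimizes the distance along the line through \<open>p\<close>.\<close>
    define t where "t = inner (x - p) s / inner s s"
    have "p + t *\<^sub>R s \<in> S" using S s pS by (intro subspace_add subspace_scale)
    then have "norm (x - p) \<le> norm (x - (p + t *\<^sub>R s))" using pd d(2) by force
    then have "inner (x - p) (x - p) \<le> inner ((x - p) - t *\<^sub>R s) ((x - p) - t *\<^sub>R s)"
      by (simp add: norm_le diff_diff_eq)
    also have "\<dots> = inner (x - p) (x - p) - 2 * t * inner (x - p) s + t * t * inner s s"
      by (simp add: inner_diff_left[of "x-p"] inner_diff_right[of _ "x-p"] inner_commute)
    also have "t * t * inner s s = t * inner (x - p) s"
      using False by (simp add: t_def)
    finally have "(inner (x - p) s)\<^sup>2 / inner s s \<le> 0"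
      by (simp add: t_def power2_eq_square)
    moreover have "inner s s > 0" using False by simp
    ultimately show ?thesis
      by (simp add: divide_le_0_iff)
  qed simp
  then show ?thesis using pS by blast
qed

text \<open>A functional that is not identically zero is represented by a rescaled vector orthogonal
  to its closed kernel, obtained by projecting a point outside the kernel.\<close>

lemma riesz_representation:
  fixes f :: "'a::{real_inner, complete_space} \<Rightarrow> real"
  assumes f: "bounded_linear f"
  shows "\<exists>z. \<forall>x. f x = inner x z"
proof (cases "\<forall>x. f x = 0")
  case True
  then show ?thesis by (intro exI[of _ 0]) simp
next
  case False
  then obtain x0 where x0: "f x0 \<noteq> 0" by blast
  interpret bounded_linear f by fact
  have "closed {x. f x = 0}"
    by (intro closed_Collect_eq continuous_on_const linear_continuous_on f)
  moreover have "subspace {x. f x = 0}"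
    by (auto simp: subspace_def add scaleR)
  ultimately obtain p where p: "f p = 0" "\<And>s. f s = 0 \<Longrightarrow> inner (x0 - p) s = 0"
    using real_projection_exists[of "{x. f x = 0}" x0] by auto
  define z where "z = x0 - p"
  have fz: "f z \<noteq> 0" using x0 p by (simp add: z_def diff)
  then have z0: "inner z z \<noteq> 0" by (auto simp: zero)
  have "f x = inner x ((f z / inner z z) *\<^sub>R z)" for x
  proof -
    have "inner z (f x *\<^sub>R z - f z *\<^sub>R x) = 0"
      unfolding z_def by (rule p(2)) (simp add: z_def[symmetric] diff scaleR)
    then show ?thesis using z0 by (simp add: inner_diff_right field_simps inner_commute)
  qed
  then show ?thesis by blast
qed

section \<open>Orthogonal projections onto closed complex subspaces\<close>

lemma csubspace_imp_subspace: "complex_vector.subspace S \<Longrightarrow> subspace S"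
  by (simp add: complex_vector.subspace_def subspace_def flip: scaleC_of_real)

text \<open>A complex subspace contains \<open>\<i> *\<^sub>C s\<close> along with \<open>s\<close>;
  real orthogonality to both kills the real and the imaginary part of \<open>cinner\<close>.\<close>

lemma projection_exists:
  fixes S :: "'a::complex_hilbert set"
  assumes "closed S" "complex_vector.subspace S"
  shows "\<exists>p\<in>S. x - p \<in> orth S"
proof -
  obtain p where p: "p \<in> S" "\<And>s. s \<in> S \<Longrightarrow> inner (x - p) s = 0"
    using real_projection_exists[OF assms(1) csubspace_imp_subspace[OF assms(2)]] by blast
  have "cinner (x - p) s = 0" if "s \<in> S" for s
    using p(2)[OF that] p(2)[OF complex_vector.subspace_scale[OF assms(2) that]]
    by (simp add: complex_eq_iff Re_cinner Im_cinner)
  then show ?thesis using p(1) by (auto simp: orth_def)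
qed

lemma csubspace_orth: "complex_vector.subspace (orth S)"
  by (auto simp: complex_vector.subspace_def orth_def cinner_add_left cinner_scaleC_left)

lemma closed_orth: "closed (orth (S::'a::complex_hilbert set))"
proof -
  have "orth S = (\<Inter>s\<in>S. {x. cinner x s = 0})" by (auto simp: orth_def)
  then show ?thesis
    by (auto intro!: closed_INT closed_Collect_eq continuous_on_const
        linear_continuous_on bounded_linear_cinner_left)
qed

lemma orth_Int: "x \<in> S \<Longrightarrow> x \<in> orth S \<Longrightarrow> x = 0"
  by (auto simp: orth_def)

lemma orth_proj_eqI:
  assumes "complex_vector.subspace S" "p \<in> S" "x - p \<in> orth S"
  shows "orth_proj S x = p"
  unfolding orth_proj_def
proof (rule the_equality)
  fix q assume q: "q \<in> S \<and> x - q \<in> orth S"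
  have "q - p \<in> S" using assms q by (simp add: complex_vector.subspace_diff)
  moreover have "(x - p) - (x - q) \<in> orth S"
    using assms q csubspace_orth complex_vector.subspace_diff by blast
  ultimately have "q - p = 0" by (intro orth_Int[of _ S]) auto
  then show "q = p" by simp
qed (use assms in auto)

lemma orth_proj_props:
  assumes "complex_vector.subspace S" "closed S"
  shows "orth_proj S x \<in> S" "x - orth_proj S x \<in> orth S"
proof -
  obtain p where p: "p \<in> S" "x - p \<in> orth S" using projection_exists[OF assms(2,1)] by blast
  then show "orth_proj S x \<in> S" "x - orth_proj S x \<in> orth S"
    by (simp_all add: orth_proj_eqI[OF assms(1) p])
qed

text \<open>Riesz representation of the real functional \<open>x \<mapsto> inner (T x) y\<close>
  gives the real parts; the imaginary parts follow on replacing \<open>x\<close> by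
  \<open>\<i> *\<^sub>C x\<close>, as \<open>T\<close> is complex linear.\<close>

lemma hilbert_adjoint_exists:
  fixes T :: "'a::complex_hilbert \<Rightarrow> 'b::complex_hilbert"
  assumes "clinear T" "bounded_linear T"
  shows "\<exists>S. \<forall>x y. cinner (T x) y = cinner x (S y)"
proof -
  have "\<exists>z. \<forall>x. cinner (T x) y = cinner x z" for y
  proof -
    have "bounded_linear (\<lambda>x. inner (T x) y)"
      by (rule bounded_linear_compose[OF bounded_linear_inner_left assms(2)])
    then obtain z where z: "\<And>x. inner (T x) y = inner x z"
      using riesz_representation by blast
    have "cinner (T x) y = cinner x z" for x
    proof (rule complex_eqI)
      show "Re (cinner (T x) y) = Re (cinner x z)" by (simp add: Re_cinner z)
      have "Re (cinner (T (\<i> *\<^sub>C x)) y) = Re (cinner (\<i> *\<^sub>C x) z)" by (simp add: Re_cinner z)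
      then show "Im (cinner (T x) y) = Im (cinner x z)"
        by (simp add: clinear_scaleC[OF assms(1)] cinner_scaleC_left)
    qed
    then show ?thesis by blast
  qed
  then show ?thesis by metis
qed

lemma hilbert_adjoint_eqI:
  assumes "\<And>x y. cinner (T x) y = cinner x (S y)"
  shows "hilbert_adjoint T = S"
  unfolding hilbert_adjoint_def
proof (rule the_equality)
  fix S' assume S': "\<forall>x y. cinner (T x) y = cinner x (S' y)"
  show "S' = S"
    by (rule ext, rule cinner_eqI) (metis S' assms)
qed (use assms in auto)

lemma cinner_hilbert_adjoint:
  assumes "clinear T" "bounded_linear T"
  shows "cinner (T x) y = cinner x (hilbert_adjoint T y)"
proof -
  obtain S where S: "\<And>x y. cinner (T x) y = cinner x (S y)"
    using hilbert_adjoint_exists[OF assms] by blast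
  then show ?thesis by (simp add: hilbert_adjoint_eqI[of T S])
qed

lemma clinear_adjoint:
  assumes "\<And>x y. cinner (T x) y = cinner x (S y)"
  shows "clinear S"
  by (rule clinearI; rule cinner_eqI)
    (simp_all flip: assms add: cinner_add_right cinner_scaleC_right)

lemma norm_adjoint_le:
  assumes adj: "\<And>x y. cinner (T x) y = cinner x (S y)" and T: "\<And>x. norm (T x) \<le> B * norm x"
    and B: "0 \<le> B"
  shows "norm (S y) \<le> B * norm y"
proof (cases "S y = 0")
  case True
  then show ?thesis using B by simp
next
  case False
  \<comment> \<open>Test the adjoint relation at \<open>x = S y\<close>.\<close>
  have "(norm (S y))\<^sup>2 = cmod (cinner (T (S y)) y)"
    by (simp only: adj cinner_self norm_of_real) simp
  also have "\<dots> \<le> (B * norm (S y)) * norm y"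
    by (rule order_trans[OF norm_cinner_le]) (intro mult_right_mono T norm_ge_zero)
  finally show ?thesis using False by (simp add: power2_eq_square algebra_simps)
qed

section \<open>Operators that are onto up to finitely many dimensions\<close>

text \<open>The uniform boundedness principle for the functionals \<open>inner f\<close>: the closed
  sets \<open>E n\<close> on which all of them are bounded by \<open>n\<close> cover the space, so
  by Baire one of them contains a ball, with the same bound for all \<open>f\<close>.\<close>

lemma pointwise_bounded_imp_bounded:
  fixes S :: "'a::{real_inner, complete_space} set"
  assumes "\<And>x. \<exists>M. \<forall>f\<in>S. \<bar>inner f x\<bar> \<le> M"
  shows "\<exists>C. \<forall>f\<in>S. norm f \<le> C"
proof -
  define E where "E n = (\<Inter>f\<in>S. {x. \<bar>inner f x\<bar> \<le> real n})" for n :: nat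
  have cl: "closed (E n)" for n
    unfolding E_def by (intro closed_INT ballI closed_Collect_le continuous_intros)
  have "x \<in> (\<Union>n. E n)" for x
  proof -
    obtain M where "\<forall>f\<in>S. \<bar>inner f x\<bar> \<le> M" using assms by blast
    moreover obtain n :: nat where "M \<le> n" using real_arch_simple by blast
    ultimately have "x \<in> E n" unfolding E_def by (auto intro: order_trans)
    then show ?thesis by blast
  qed
  then have U: "(\<Union>n. E n) = UNIV" by blast
  have "\<exists>n. interior (E n) \<noteq> {}"
  proof (rule ccontr)
    assume "\<not> ?thesis"
    then have "Met_TC.mtopology interior_of \<Union>(range E) = {}"
      using cl by (intro Met_TC.metric_Baire_category_alt) (auto simp: complete_UNIV)
    then show False using U by simp
  qed
  then obtain n x r where r: "r > 0" "cball x r \<subseteq> E n"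
    by (metis all_not_in_conv mem_interior_cball)
  have "norm f \<le> 2 * n / r" if f: "f \<in> S" for f
  proof (cases "f = 0")
    case False
    \<comment> \<open>Compare the centre of the ball with the point at distance \<open>r\<close> in
      direction \<open>f\<close>: the values of \<open>inner f\<close> differ by
      \<open>r * norm f\<close>, and by at most \<open>2 * n\<close>.\<close>
    have "x \<in> E n" "x + (r / norm f) *\<^sub>R f \<in> E n"
      using r False by (auto simp: dist_norm intro!: subsetD[OF r(2)])
    then have "\<bar>inner f x\<bar> \<le> n" "\<bar>inner f x + (r / norm f) * inner f f\<bar> \<le> n"
      using f by (auto simp: E_def inner_add_right)
    then have "(r / norm f) * inner f f \<le> 2 * n" by linarith
    also have "(r / norm f) * inner f f = r * norm f"
      using False by (simp add: power2_norm_eq_inner[symmetric] power2_eq_square)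
    finally show ?thesis using r by (simp add: field_simps)
  qed (use r in simp)
  then show ?thesis by blast
qed

text \<open>The seminorm \<open>N\<close> formed by the parenthesis on the right has a weakly
  bounded unit ball: the sum controls pairings with \<open>B\<close>, the term
  \<open>norm (D f)\<close> controls those with \<open>range A\<close> through the adjoint relation,
  and these vectors span. Uniform boundedness makes the ball norm bounded, and homogeneity gives the
  estimate.\<close>

lemma bounded_below_modulo_finite:
  fixes D :: "'a::complex_hilbert \<Rightarrow> 'b::complex_hilbert" and A :: "'b \<Rightarrow> 'a"
  assumes D: "clinear D" and adj: "\<And>h f. cinner (A h) f = cinner h (D f)"
    and B: "finite B" "complex_vector.span (B \<union> range A) = UNIV"
  shows "\<exists>C>0. \<forall>f. norm f \<le> C * (norm (D f) + (\<Sum>b\<in>B. cmod (cinner f b)))"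
proof -
  define N where "N f = norm (D f) + (\<Sum>b\<in>B. cmod (cinner f b))" for f
  have N_scale: "N (r *\<^sub>R f) = r * N f" if "r \<ge> 0" for r f
    using that by (simp add: N_def clinear_scaleR[OF D] cinner_scaleR_left norm_mult
        sum_distrib_left distrib_left)
  have N_nonneg: "N f \<ge> 0" for f
    by (simp add: N_def sum_nonneg)
  have weak: "\<exists>M. \<forall>f. N f \<le> 1 \<longrightarrow> cmod (cinner x f) \<le> M" for x
  proof -
    have "x \<in> complex_vector.span (B \<union> range A)" using B by simp
    then show ?thesis
    proof (induction rule: complex_vector.span_induct_alt)
      case base
      show ?case by (intro exI[of _ 0]) simp
    next
      case (step c x y)
      have "\<exists>M. \<forall>f. N f \<le> 1 \<longrightarrow> cmod (cinner x f) \<le> M"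
        using step(1)
      proof
        assume x: "x \<in> B"
        have "cmod (cinner x f) \<le> N f" for f
        proof -
          have "cmod (cinner x f) = cmod (cinner f x)"
            by (metis cinner_commute complex_mod_cnj)
          also have "\<dots> \<le> (\<Sum>b\<in>B. cmod (cinner f b))"
            using member_le_sum[OF x, of "\<lambda>b. cmod (cinner f b)"] B(1) by simp
          finally show ?thesis by (simp add: N_def add_increasing)
        qed
        then show ?thesis by (meson order_trans)
      next
        assume "x \<in> range A"
        then obtain h where h: "x = A h" by blast
        have "cmod (cinner x f) \<le> norm h" if "N f \<le> 1" for f
        proof -
          have "norm (D f) \<le> 1" using that sum_nonneg[of B "\<lambda>b. cmod (cinner f b)"]
            by (simp add: N_def)
          then have "norm h * norm (D f) \<le> norm h" by (simp add: mult_left_le)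
          then show ?thesis using norm_cinner_le[of h "D f"] by (simp add: h adj)
        qed
        then show ?thesis by blast
      qed
      then obtain M1 M2 where M: "\<And>f. N f \<le> 1 \<Longrightarrow> cmod (cinner x f) \<le> M1"
        "\<And>f. N f \<le> 1 \<Longrightarrow> cmod (cinner y f) \<le> M2" using step by blast
      have "cmod (cinner (c *\<^sub>C x + y) f) \<le> cmod c * M1 + M2" if "N f \<le> 1" for f
        using M[OF that] by (simp add: cinner_add_left cinner_scaleC_left
            norm_triangle_le norm_mult add_mono mult_left_mono)
      then show ?case by blast
    qed
  qed
  have "\<exists>C. \<forall>f\<in>{f. N f \<le> 1}. norm f \<le> C"
  proof (rule pointwise_bounded_imp_bounded)
    fix x
    obtain M where M: "\<And>f. N f \<le> 1 \<Longrightarrow> cmod (cinner x f) \<le> M" using weak by blast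
    have "\<bar>inner f x\<bar> \<le> M" if "N f \<le> 1" for f
      using M[OF that] abs_Re_le_cmod[of "cinner x f"] by (simp add: Re_cinner inner_commute)
    then show "\<exists>M. \<forall>f\<in>{f. N f \<le> 1}. \<bar>inner f x\<bar> \<le> M" by blast
  qed
  then obtain C where C: "\<And>f. N f \<le> 1 \<Longrightarrow> norm f \<le> C" by blast
  have C0: "C \<ge> 0" using C[of 0] N_scale[of 0 0] by simp
  have "norm f \<le> (C + 1) * N f" for f
  proof (cases "N f = 0")
    case True
    \<comment> \<open>All nonnegative multiples of \<open>f\<close> lie in the unit ball of
      \<open>N\<close>, which is norm bounded, so \<open>f = 0\<close>.\<close>
    then have "norm (r *\<^sub>R f) \<le> C" if "r \<ge> 0" for r
      using that by (intro C) (simp add: N_scale)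
    from this[of "(C + 1) / norm f"] C0 have "f = 0" by (cases "f = 0") auto
    then show ?thesis using True by simp
  next
    case False
    then have pos: "N f > 0" using N_nonneg[of f] by simp
    then have "norm ((1 / N f) *\<^sub>R f) \<le> C"
      by (intro C) (subst N_scale, auto)
    then have "norm f \<le> C * N f" using pos by (simp add: field_simps)
    then show ?thesis using pos by (simp add: algebra_simps)
  qed
  then show ?thesis unfolding N_def using C0 by (intro exI[of _ "C + 1"]) auto
qed

section \<open>Linearity of projections, and bounds on the complement of a kernel\<close>

lemma clinear_orth_proj:
  fixes S :: "'a::complex_hilbert set"
  assumes S: "complex_vector.subspace S" "closed S"
  shows "clinear (orth_proj S)"
proof (rule clinearI; rule orth_proj_eqI[OF S(1)])
  fix x y :: 'a and c :: complex
  let ?P = "orth_proj S"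
  have "(x - ?P x) + (y - ?P y) \<in> orth S" "c *\<^sub>C (x - ?P x) \<in> orth S"
    using orth_proj_props(2)[OF S] complex_vector.subspace_add[OF csubspace_orth]
      complex_vector.subspace_scale[OF csubspace_orth] by blast+
  then show "x + y - (?P x + ?P y) \<in> orth S" "c *\<^sub>C x - c *\<^sub>C ?P x \<in> orth S"
    by (simp_all add: algebra_simps complex_vector.scale_right_diff_distrib)
  show "?P x + ?P y \<in> S" "c *\<^sub>C ?P x \<in> S"
    using orth_proj_props(1)[OF S] complex_vector.subspace_add[OF S(1)]
      complex_vector.subspace_scale[OF S(1)] by blast+
qed

lemma csubspace_ker: "clinear D \<Longrightarrow> complex_vector.subspace (ker D)"
  for D :: "'a::complex_hilbert \<Rightarrow> 'b::complex_hilbert"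
  using clinear_scaleC[of D 0 0]
  by (auto simp: complex_vector.subspace_def ker_def clinear_add clinear_scaleC)

lemma closed_ker: "bounded_linear D \<Longrightarrow> closed (ker D)"
  unfolding ker_def by (intro closed_Collect_eq linear_continuous_on continuous_on_const)

text \<open>The functionals are removed one at a time. If this failed for \<open>b\<close>, there
  would be unit vectors in \<open>orth (ker D)\<close> on which the remaining seminorm tends to
  zero. Along a subsequence their pairings with \<open>b\<close> converge, so the assumed estimate
  makes them Cauchy; the limit is a unit vector in both \<open>ker D\<close> and its orthogonal
  complement.\<close>

lemma bounded_below_on_orth_ker:
  fixes D :: "'a::complex_hilbert \<Rightarrow> 'b::complex_hilbert"
  assumes D: "clinear D" "bounded_linear D"
    and "finite B" "C > 0"
    and "\<And>f. f \<in> orth (ker D) \<Longrightarrow> norm f \<le> C * (norm (D f) + (\<Sum>b\<in>B. cmod (cinner f b)))"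
  shows "\<exists>C>0. \<forall>f\<in>orth (ker D). norm f \<le> C * norm (D f)"
  using assms(3-)
proof (induction B arbitrary: C rule: finite_induct)
  case empty
  then show ?case by auto
next
  case (insert b B)
  define L where "L = orth (ker D)"
  define N where "N f = norm (D f) + (\<Sum>b\<in>B. cmod (cinner f b))" for f
  interpret D: bounded_linear D by fact
  have N_diff: "N (f - g) \<le> N f + N g" for f g
  proof -
    have "(\<Sum>b\<in>B. cmod (cinner (f - g) b)) \<le> (\<Sum>b\<in>B. cmod (cinner f b) + cmod (cinner g b))"
      by (intro sum_mono) (simp add: cinner_diff_left norm_triangle_ineq4)
    then show ?thesis
      using norm_triangle_ineq4[of "D f" "D g"] by (simp add: N_def D.diff sum.distrib)
  qed
  have N_scale: "N (r *\<^sub>R f) = r * N f" if "r \<ge> 0" for r f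
    using that by (simp add: N_def D.scaleR cinner_scaleR_left norm_mult
        sum_distrib_left distrib_left)
  have bound: "norm f \<le> C * (N f + cmod (cinner f b))" if "f \<in> L" for f
    using insert.prems(2)[of f] that insert.hyps by (simp add: L_def N_def algebra_simps)
  have subL: "complex_vector.subspace L" unfolding L_def by (rule csubspace_orth)
  have "\<exists>C'>0. \<forall>f\<in>L. norm f \<le> C' * N f"
  proof (rule ccontr)
    assume contra: "\<not> ?thesis"
    have "\<exists>f\<in>L. norm f = 1 \<and> N f < 1 / Suc n" for n
    proof -
      obtain f where f: "f \<in> L" "norm f > Suc n * N f"
        using contra by (metis of_nat_0_less_iff zero_less_Suc not_le)
      have "N f \<ge> 0" by (simp add: N_def sum_nonneg)
      then have n: "norm f > 0" using f(2) by (smt (verit) mult_nonneg_nonneg of_nat_0_le_iff)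
      have "(1 / norm f) *\<^sub>R f \<in> L"
        using f(1) csubspace_imp_subspace[OF subL] by (simp add: subspace_scale)
      moreover have "N ((1 / norm f) *\<^sub>R f) < 1 / Suc n"
        using n f(2) by (simp add: N_scale field_simps)
      ultimately show ?thesis using n by (intro bexI[of _ "(1 / norm f) *\<^sub>R f"]) auto
    qed
    then obtain g where g: "\<And>n. g n \<in> L" "\<And>n. norm (g n) = 1" "\<And>n. N (g n) < 1 / Suc n"
      by metis
    have "cmod (cinner (g n) b) \<le> norm b" for n
      using norm_cinner_le[of "g n" b] g(2)[of n] by simp
    then have "bounded (range (\<lambda>n. cinner (g n) b))"
      by (intro boundedI[of _ "norm b"]) auto
    then obtain l r where r: "strict_mono (r :: nat \<Rightarrow> nat)"
      and l: "((\<lambda>n. cinner (g n) b) \<circ> r) \<longlonglongrightarrow> l"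
      using bounded_imp_convergent_subsequence by blast
    define h where "h = g \<circ> r"
    have N0: "(\<lambda>n. N (h n)) \<longlonglongrightarrow> 0"
    proof (rule tendsto_sandwich[OF _ _ tendsto_const])
      show "\<forall>\<^sub>F n in sequentially. 0 \<le> N (h n)"
        by (intro always_eventually) (simp add: N_def sum_nonneg)
      have "N (h n) \<le> 1 / Suc n" for n
      proof -
        have "1 / real (Suc (r n)) \<le> 1 / Suc n"
          using seq_suble[OF r, of n] by (simp add: frac_le)
        then show ?thesis using g(3)[of "r n"] by (simp add: h_def)
      qed
      then show "\<forall>\<^sub>F n in sequentially. N (h n) \<le> 1 / Suc n" by simp
      show "(\<lambda>n. 1 / real (Suc n)) \<longlonglongrightarrow> 0" by (intro LIMSEQ_Suc[OF lim_1_over_n])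
    qed
    have cau: "Cauchy (\<lambda>n. cinner (h n) b)"
      using l by (intro LIMSEQ_imp_Cauchy[of _ l]) (simp add: h_def o_def)
    have "Cauchy h"
    proof (rule metric_CauchyI)
      fix e :: real assume e: "e > 0"
      \<comment> \<open>One third each for \<open>N (h m)\<close>, \<open>N (h n)\<close> and the
        difference of the pairings with \<open>b\<close>, scaled by the constant of the
        estimate.\<close>
      define d where "d = e / (3 * C)"
      have d: "d > 0" using e insert.prems by (simp add: d_def)
      obtain n1 where n1: "\<And>n. n \<ge> n1 \<Longrightarrow> N (h n) < d"
        using order_tendstoD(2)[OF N0 d] by (auto simp: eventually_sequentially)
      obtain n2 where n2: "\<And>m n. m \<ge> n2 \<Longrightarrow> n \<ge> n2 \<Longrightarrow> cmod (cinner (h m) b - cinner (h n) b) < d"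
        using CauchyD[OF cau d] by blast
      have "dist (h m) (h n) < e" if "m \<ge> max n1 n2" "n \<ge> max n1 n2" for m n
      proof -
        have "h m - h n \<in> L"
          using g(1) complex_vector.subspace_diff[OF subL] by (simp add: h_def)
        then have "dist (h m) (h n) \<le> C * (N (h m - h n) + cmod (cinner (h m - h n) b))"
          by (simp add: dist_norm bound)
        also have "\<dots> < C * (3 * d)"
          using N_diff[of "h m" "h n"] n1[of m] n1[of n] n2[of m n] that insert.prems
          by (intro mult_strict_left_mono) (auto simp: cinner_diff_left)
        also have "\<dots> = e" using insert.prems by (simp add: d_def)
        finally show ?thesis .
      qed
      then show "\<exists>M. \<forall>m\<ge>M. \<forall>n\<ge>M. dist (h m) (h n) < e" by blast
    qed
    then obtain f where f: "h \<longlonglongrightarrow> f" using Cauchy_convergent_iff convergent_def by blast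
    have fL: "f \<in> L"
    proof (rule closed_sequentially[OF _ _ f])
      show "closed L" by (simp add: L_def closed_orth)
      show "h n \<in> L" for n by (simp add: h_def g(1))
    qed
    have "norm f = 1"
      using tendsto_norm[OF f] g(2) LIMSEQ_unique[OF _ tendsto_const] by (simp add: h_def)
    have "(\<lambda>n. D (h n)) \<longlonglongrightarrow> 0"
    proof (rule Lim_null_comparison[OF _ N0])
      show "\<forall>\<^sub>F n in sequentially. norm (D (h n)) \<le> N (h n)"
        by (intro always_eventually) (simp add: N_def sum_nonneg)
    qed
    then have "D f = 0" using D.tendsto[OF f] LIMSEQ_unique by blast
    then have "f = 0" using fL by (intro orth_Int[of _ "ker D"]) (auto simp: L_def ker_def)
    then show False using \<open>norm f = 1\<close> by simp
  qed
  then show ?case using insert.IH by (auto simp: L_def N_def)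
qed

section \<open>The Moore--Penrose inverse of an operator with closed range\<close>

text \<open>Closed range in quantitative form: a lower bound on the complement of the kernel yields
  both the closed range and the bounded inverse on it.\<close>

locale closed_range_operator =
  fixes D :: "'a::complex_hilbert \<Rightarrow> 'b::complex_hilbert"
  assumes clinear_D: "clinear D" and bounded_D: "bounded_linear D"
    and bounded_below: "\<exists>C>0. \<forall>f\<in>orth (ker D). norm f \<le> C * norm (D f)"
begin

interpretation D: Vector_Spaces.linear scaleC scaleC D by (rule clinear_D)

lemma orth_ker_decomp: "\<exists>p\<in>orth (ker D). D x = D p"
proof -
  obtain p where p: "p \<in> ker D" "x - p \<in> orth (ker D)"
    using projection_exists[OF closed_ker[OF bounded_D] csubspace_ker[OF clinear_D]] by blast
  then have "D x = D (x - p)" by (simp add: D.diff ker_def)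
  then show ?thesis using p(2) by blast
qed

lemma range_orth_ker: "y \<in> range D \<Longrightarrow> \<exists>x\<in>orth (ker D). y = D x"
  using orth_ker_decomp by auto

lemma inj_on_orth_ker:
  assumes "x \<in> orth (ker D)" "y \<in> orth (ker D)" "D x = D y"
  shows "x = y"
proof -
  have "x - y \<in> orth (ker D)" using assms csubspace_orth complex_vector.subspace_diff by blast
  moreover have "x - y \<in> ker D" using assms by (simp add: ker_def D.diff)
  ultimately have "x - y = 0" by (intro orth_Int)
  then show ?thesis by simp
qed

lemma csubspace_range: "complex_vector.subspace (range D)"
  using D.subspace_image complex_vector.subspace_UNIV by blast

lemma closed_range: "closed (range D)"
proof -
  obtain C where C: "C > 0" "\<And>f. f \<in> orth (ker D) \<Longrightarrow> norm f \<le> C * norm (D f)"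
    using bounded_below by blast
  have "complete (D ` orth (ker D))"
    using C by (intro complete_isometric_image[of "1 / C"] bounded_D
        csubspace_imp_subspace csubspace_orth)
      (auto simp: field_simps complete_eq_closed closed_orth)
  moreover have "D ` orth (ker D) = range D" using orth_ker_decomp by blast
  ultimately show ?thesis using complete_imp_closed by metis
qed

lemmas proj_range = orth_proj_props[OF csubspace_range closed_range]
lemmas proj_rangeI = orth_proj_eqI[OF csubspace_range]

lemmas clinear_proj_range = clinear_orth_proj[OF csubspace_range closed_range]

lemma norm_proj_range_le: "norm (orth_proj (range D) y) \<le> norm y"
proof -
  let ?p = "orth_proj (range D) y"
  have "cinner (y - ?p) ?p = 0" using proj_range[of y] unfolding orth_def by blast
  then have "inner (y - ?p) ?p = 0" by (simp flip: Re_cinner)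
  then have "inner ?p ?p = inner y ?p" by (simp add: inner_diff_left)
  also have "\<dots> \<le> norm y * norm ?p" by (rule norm_cauchy_schwarz)
  finally have "norm ?p * norm ?p \<le> norm y * norm ?p"
    by (simp add: power2_norm_eq_inner[symmetric] power2_eq_square)
  then show ?thesis by (cases "norm ?p = 0") auto
qed

text \<open>As the range is closed, every \<open>y\<close> is the sum of \<open>D x\<close> with
  \<open>x\<close> in \<open>orth (ker D)\<close> and a vector orthogonal to the range; the
  conditions fix \<open>R\<close> on both summands.\<close>

lemma moore_penrose_eqI:
  assumes R: "clinear R" "\<And>y. y \<in> orth (range D) \<Longrightarrow> R y = 0"
    "\<And>x. x \<in> orth (ker D) \<Longrightarrow> R (D x) = x"
  shows "moore_penrose D = R"
  unfolding moore_penrose_def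
proof (rule the_equality)
  fix R' assume R': "clinear R' \<and> (\<forall>y\<in>orth (range D). R' y = 0) \<and> (\<forall>x\<in>orth (ker D). R' (D x) = x)"
  show "R' = R"
  proof
    fix y
    obtain x where x: "x \<in> orth (ker D)" "orth_proj (range D) y = D x"
      using range_orth_ker[OF proj_range(1)] by blast
    have "y - D x \<in> orth (range D)" using x(2) proj_range(2)[of y] by simp
    then have "R' (D x + (y - D x)) = x" "R (D x + (y - D x)) = x"
      using R R' x(1) by (simp_all only: clinear_add) simp_all
    then show "R' y = R y" by simp
  qed
qed (use R in auto)

text \<open>For each \<open>y\<close> let \<open>R y\<close> be the vector of
  \<open>orth (ker D)\<close> that \<open>D\<close> sends to the projection of \<open>y\<close>.
  Since \<open>D\<close> is injective on \<open>orth (ker D)\<close>, the algebraic identities for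
  \<open>R\<close> follow by applying \<open>D\<close> to both sides.\<close>

lemma moore_penrose_props:
  shows moore_penrose_orth_ker: "moore_penrose D y \<in> orth (ker D)"
    and D_moore_penrose: "D (moore_penrose D y) = orth_proj (range D) y"
    and clinear_moore_penrose: "clinear (moore_penrose D)"
    and bounded_moore_penrose: "bounded_linear (moore_penrose D)"
    and moore_penrose_D: "x \<in> orth (ker D) \<Longrightarrow> moore_penrose D (D x) = x"
proof -
  have "\<exists>x\<in>orth (ker D). D x = orth_proj (range D) y" for y
    using range_orth_ker[OF proj_range(1), of y] by metis
  then obtain R where R: "\<And>y. R y \<in> orth (ker D)" "\<And>y. D (R y) = orth_proj (range D) y"
    by metis
  note eqI = inj_on_orth_ker[OF R(1)]
  have lin: "clinear R"
    by (rule clinearI; rule eqI)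
      (simp_all add: R D.add D.scale complex_vector.subspace_add[OF csubspace_orth]
        complex_vector.subspace_scale[OF csubspace_orth]
        clinear_add[OF clinear_proj_range] clinear_scaleC[OF clinear_proj_range])
  have RD: "R (D x) = x" if "x \<in> orth (ker D)" for x
    by (rule eqI[OF that]) (simp add: R proj_rangeI orth_def)
  have R0: "R y = 0" if "y \<in> orth (range D)" for y
    using that complex_vector.subspace_0[OF csubspace_orth] complex_vector.subspace_0[OF csubspace_range]
    by (intro eqI) (simp_all add: R proj_rangeI D.zero)
  have mp: "moore_penrose D = R" using lin R0 RD by (rule moore_penrose_eqI)
  obtain C where C: "C > 0" "\<And>f. f \<in> orth (ker D) \<Longrightarrow> norm f \<le> C * norm (D f)"
    using bounded_below by blast
  have "norm (R y) \<le> C * norm y" for y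
    using C(2)[OF R(1)[of y]] norm_proj_range_le[of y] C(1) unfolding R
    by (meson dual_order.trans less_imp_le mult_left_mono)
  then have "bounded_linear R" by (rule clinear_bounded[OF lin])
  with R lin RD show "moore_penrose D y \<in> orth (ker D)"
    "D (moore_penrose D y) = orth_proj (range D) y" "clinear (moore_penrose D)"
    "bounded_linear (moore_penrose D)" "x \<in> orth (ker D) \<Longrightarrow> moore_penrose D (D x) = x"
    by (simp_all add: mp)
qed

text \<open>Orthogonality of \<open>D f - y\<close> to the range says that \<open>D f\<close> is the
  projection of \<open>y\<close>, which is \<open>D (moore_penrose D y)\<close>. This turns the
  fibre condition into membership of a perturbation of \<open>f\<close> in the fixed space
  \<open>ker D\<close>.\<close>

lemma diff_orth_range_iff:
  "D f - y \<in> orth (range D) \<longleftrightarrow> f - moore_penrose D y \<in> ker D"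
proof
  assume "D f - y \<in> orth (range D)"
  then have "- (D f - y) \<in> orth (range D)"
    by (rule complex_vector.subspace_neg[OF csubspace_orth])
  then have "orth_proj (range D) y = D f" by (intro proj_rangeI) auto
  then show "f - moore_penrose D y \<in> ker D" by (simp add: ker_def D.diff D_moore_penrose)
next
  assume "f - moore_penrose D y \<in> ker D"
  then have "D f = orth_proj (range D) y" by (simp add: ker_def D.diff D_moore_penrose)
  then have "- (D f - y) \<in> orth (range D)" using proj_range(2)[of y] by simp
  then show "D f - y \<in> orth (range D)"
    using complex_vector.subspace_neg[OF csubspace_orth] by fastforce
qed

lemma orth_proj_range_eq_0_iff: "orth_proj (range D) y = 0 \<longleftrightarrow> y \<in> orth (range D)"
  using proj_range(2)[of y] proj_rangeI[of 0 y] complex_vector.subspace_0[OF csubspace_range] by auto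

lemma moore_penrose_eq_0:
  assumes "y \<in> orth (range D)"
  shows "moore_penrose D y = 0"
proof -
  have "D (moore_penrose D y) = 0"
    using assms by (simp add: D_moore_penrose orth_proj_range_eq_0_iff)
  then show ?thesis
    using moore_penrose_orth_ker by (intro orth_Int[of _ "ker D"]) (auto simp: ker_def)
qed

end

text \<open>The adjoint relation makes \<open>range A\<close> orthogonal to \<open>ker D\<close>, so
  the projection kills it and the images of \<open>B\<close> alone span. For finite \<open>B\<close>
  the kernel is finite dimensional.\<close>

lemma ker_eq_span_projection:
  fixes D :: "'a::complex_hilbert \<Rightarrow> 'b::complex_hilbert"
  assumes D: "clinear D" "bounded_linear D"
    and adj: "\<And>h f. cinner (A h) f = cinner h (D f)"
    and B: "complex_vector.span (B \<union> range A) = UNIV"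
  shows "ker D = complex_vector.span (orth_proj (ker D) ` B)"
proof
  note K = csubspace_ker[OF D(1)] closed_ker[OF D(2)]
  let ?Q = "orth_proj (ker D)"
  interpret Q: Vector_Spaces.linear scaleC scaleC ?Q by (rule clinear_orth_proj[OF K])
  have QA: "?Q (A h) = 0" for h
  proof (rule orth_proj_eqI[OF K(1) complex_vector.subspace_0[OF K(1)]])
    show "A h - 0 \<in> orth (ker D)" by (simp add: orth_def adj ker_def)
  qed
  have "?Q x \<in> complex_vector.span (?Q ` B)" for x
  proof -
    have "?Q x \<in> ?Q ` complex_vector.span (B \<union> range A)" by (simp add: B)
    also have "\<dots> = complex_vector.span (?Q ` (B \<union> range A))" by (rule Q.span_image[symmetric])
    also have "\<dots> \<subseteq> complex_vector.span (insert 0 (?Q ` B))"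
      by (rule complex_vector.span_mono) (auto simp: QA)
    finally show ?thesis by simp
  qed
  moreover have "?Q x = x" if "x \<in> ker D" for x
    using that by (intro orth_proj_eqI[OF K(1)]) (auto simp: orth_def)
  ultimately show "ker D \<subseteq> complex_vector.span (?Q ` B)" by (metis subsetI)
  show "complex_vector.span (?Q ` B) \<subseteq> ker D"
    by (rule complex_vector.span_minimal[OF _ K(1)]) (auto simp: orth_proj_props[OF K])
qed

section \<open>Holomorphic perturbation of a finite dimensional kernel\<close>

lemma clinear_compose: "clinear f \<Longrightarrow> clinear g \<Longrightarrow> clinear (\<lambda>x. g (f x))"
  by (rule clinearI) (simp_all add: clinear_add clinear_scaleC)

lemma clinear_diff: "clinear f \<Longrightarrow> f (x - y) = f x - f y"
  using clinear_add[of f "x - y" y] by simp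

text \<open>Models \<open>T v f = R (v_j f)_j\<close>, with \<rho> the operator norm of the
  Moore-Penrose inverse \<open>R\<close>. Complex linearity in \<open>v\<close> is the source of
  holomorphic dependence.\<close>

locale bounded_bilinear_action =
  fixes T :: "'b::complex_hilbert \<Rightarrow> 'a::complex_hilbert \<Rightarrow> 'a" and \<rho> :: real
  assumes clinear_left: "clinear (\<lambda>v. T v f)" and clinear_right: "clinear (T v)"
    and norm_T: "norm (T v f) \<le> norm v * \<rho> * norm f" and rho_nonneg: "\<rho> \<ge> 0"
begin

text \<open>The inverse of \<open>I - T v\<close> applied to \<open>k\<close>, encoded as the fixed
  point that the contraction principle supplies when \<open>norm v * \<rho> < 1\<close>.\<close>

definition resolvent :: "'b \<Rightarrow> 'a \<Rightarrow> 'a"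
  where "resolvent v k = (THE f. f = T v f + k)"

lemma resolvent_iff:
  assumes v: "norm v * \<rho> < 1"
  shows "f = T v f + k \<longleftrightarrow> f = resolvent v k"
proof -
  have "\<exists>!f. T v f + k = f"
  proof (rule banach_fix_type[of "norm v * \<rho>"])
    show "\<forall>x y. dist (T v x + k) (T v y + k) \<le> norm v * \<rho> * dist x y"
      using norm_T[of v] by (simp add: dist_norm clinear_diff[OF clinear_right, symmetric])
  qed (use v rho_nonneg in auto)
  then have ex: "\<exists>!f. f = T v f + k" by metis
  show ?thesis
    unfolding resolvent_def using theI'[OF ex] ex by blast
qed

lemmas resolventI = resolvent_iff[THEN iffD1]

lemma resolvent_eq: "norm v * \<rho> < 1 \<Longrightarrow> resolvent v k = T v (resolvent v k) + k"
  by (rule resolvent_iff[THEN iffD2]) auto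

lemma norm_resolvent_le:
  assumes v: "norm v * \<rho> < 1"
  shows "norm (resolvent v k) \<le> norm k / (1 - norm v * \<rho>)"
proof -
  have "norm (resolvent v k) \<le> norm (T v (resolvent v k)) + norm k"
    using norm_triangle_ineq resolvent_eq[OF v, of k] by metis
  also have "norm (T v (resolvent v k)) \<le> norm v * \<rho> * norm (resolvent v k)"
    by (rule norm_T)
  finally show ?thesis using v by (simp add: field_simps)
qed

lemma clinear_resolvent:
  assumes v: "norm v * \<rho> < 1"
  shows "clinear (resolvent v)"
proof (rule clinearI; rule resolventI[OF v, symmetric])
  fix x y :: 'a and c
  have "T v (resolvent v x + resolvent v y) + (x + y)
      = (T v (resolvent v x) + x) + (T v (resolvent v y) + y)"
    by (simp add: clinear_add[OF clinear_right])
  then show "resolvent v x + resolvent v y = T v (resolvent v x + resolvent v y) + (x + y)"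
    using resolvent_eq[OF v] by metis
  have "T v (c *\<^sub>C resolvent v x) + c *\<^sub>C x = c *\<^sub>C (T v (resolvent v x) + x)"
    by (simp add: clinear_scaleC[OF clinear_right] scaleC_add_right)
  then show "c *\<^sub>C resolvent v x = T v (c *\<^sub>C resolvent v x) + c *\<^sub>C x"
    using resolvent_eq[OF v] by metis
qed

text \<open>A resolvent identity: subtracting the fixed point equations at \<open>v + h\<close> and
  \<open>v\<close> leaves an equation of the same kind for the difference.\<close>

lemma resolvent_diff_eq:
  assumes v: "norm v * \<rho> < 1" and vh: "norm (v + h) * \<rho> < 1"
  shows "resolvent (v + h) k - resolvent v k = resolvent v (T h (resolvent (v + h) k))"
proof (rule resolventI[OF v])
  let ?s = "resolvent v k" and ?s' = "resolvent (v + h) k"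
  have "?s' - ?s = (T (v + h) ?s' + k) - (T v ?s + k)"
    using resolvent_eq[OF v, of k] resolvent_eq[OF vh, of k] by simp
  also have "\<dots> = T v (?s' - ?s) + T h ?s'"
    by (simp add: clinear_add[OF clinear_left] clinear_diff[OF clinear_right])
  finally show "?s' - ?s = T v (?s' - ?s) + T h ?s'" .
qed

text \<open>The resolvent identity expresses the increment through \<open>T h\<close> at the
  perturbed solution; using it again to compare with the unperturbed solution leaves a remainder
  quadratic in \<open>h\<close>.\<close>

lemma has_derivative_resolvent:
  assumes v: "norm v * \<rho> < 1"
  shows "((\<lambda>v. resolvent v k) has_derivative (\<lambda>h. resolvent v (T h (resolvent v k)))) (at v)"
proof -
  define q where "q = 1 - norm v * \<rho>"
  have q: "q > 0" using v by (simp add: q_def)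
  let ?s = "resolvent v k"
  let ?D = "\<lambda>h. resolvent v (T h ?s)"
  have res: "norm (resolvent v x) \<le> norm x / q" for x
    unfolding q_def by (rule norm_resolvent_le[OF v])
  have "bounded_linear ?D"
  proof (rule clinear_bounded)
    show "clinear ?D" by (rule clinear_compose[OF clinear_left clinear_resolvent[OF v]])
    show "norm (?D h) \<le> (\<rho> * norm ?s / q) * norm h" for h
      using res[of "T h ?s"] norm_T[of h ?s] q by (simp add: field_simps)
  qed
  moreover have "(\<lambda>h. norm (resolvent (v + h) k - ?s - ?D h) / norm h) \<midarrow>0\<rightarrow> 0"
  proof (rule Lim_null_comparison)
    \<comment> \<open>Collects the bound \<open>norm k / (q / 2)\<close> for the perturbed solution
      and a factor \<open>\<rho> / q\<close> for each of two uses of the resolvent at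
      \<open>v\<close>.\<close>
    define K where "K = \<rho> * (\<rho> * (norm k / (q / 2)) / q) / q"
    have "norm (resolvent (v + h) k - ?s - ?D h) \<le> K * norm h * norm h"
      if h: "norm h * \<rho> < q / 2" for h
    proof -
      have le: "norm (v + h) * \<rho> \<le> norm v * \<rho> + norm h * \<rho>"
        using mult_right_mono[OF norm_triangle_ineq rho_nonneg] by (simp add: distrib_right)
      \<comment> \<open>Half of the gap \<open>q\<close> survives, which bounds the perturbed
        solutions uniformly in \<open>h\<close>.\<close>
      then have q': "1 - norm (v + h) * \<rho> \<ge> q / 2" using h by (simp add: q_def)
      then have vh: "norm (v + h) * \<rho> < 1" using q by simp
      let ?s' = "resolvent (v + h) k"
      have "norm ?s' \<le> norm k / (1 - norm (v + h) * \<rho>)" by (rule norm_resolvent_le[OF vh])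
      also have "\<dots> \<le> norm k / (q / 2)" using q q' by (intro divide_left_mono) auto
      finally have s': "norm ?s' \<le> norm k / (q / 2)" .
      have "norm (?s' - ?s) \<le> norm (T h ?s') / q"
        by (simp add: resolvent_diff_eq[OF v vh] res)
      also have "\<dots> \<le> norm h * \<rho> * (norm k / (q / 2)) / q"
        using q rho_nonneg
        by (intro divide_right_mono order_trans[OF norm_T] mult_left_mono s') auto
      finally have e: "norm (?s' - ?s) \<le> norm h * \<rho> * (norm k / (q / 2)) / q" .
      have "?s' - ?s - ?D h = resolvent v (T h ?s') - ?D h"
        by (simp only: resolvent_diff_eq[OF v vh])
      also have "\<dots> = resolvent v (T h (?s' - ?s))"
        by (simp only: clinear_diff[OF clinear_right] clinear_diff[OF clinear_resolvent[OF v]])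
      finally have "?s' - ?s - ?D h = resolvent v (T h (?s' - ?s))" .
      then have "norm (?s' - ?s - ?D h) \<le> norm (T h (?s' - ?s)) / q" by (simp add: res)
      also have "\<dots> \<le> norm h * \<rho> * (norm h * \<rho> * (norm k / (q / 2)) / q) / q"
        using q rho_nonneg
        by (intro divide_right_mono order_trans[OF norm_T] mult_left_mono e) auto
      finally show ?thesis by (simp add: K_def mult_ac)
    qed
    note bnd = this
    have "((\<lambda>h::'b. norm h * \<rho>) \<longlongrightarrow> 0) (at 0)" by (intro tendsto_eq_intros) auto
    then have "\<forall>\<^sub>F h::'b in at 0. norm h * \<rho> < q / 2"
      using q by (intro order_tendstoD) auto
    then show "\<forall>\<^sub>F h in at 0. norm (norm (resolvent (v + h) k - ?s - ?D h) / norm h) \<le> K * norm h"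
    proof (rule eventually_mono)
      fix h :: 'b assume "norm h * \<rho> < q / 2"
      from bnd[OF this] show "norm (norm (resolvent (v + h) k - ?s - ?D h) / norm h) \<le> K * norm h"
        by (cases "h = 0") (simp_all add: divide_le_eq)
    qed
    show "((\<lambda>h::'b. K * norm h) \<longlongrightarrow> 0) (at 0)" by (intro tendsto_eq_intros) auto
  qed
  ultimately show ?thesis by (simp add: has_derivative_at)
qed

lemma holomorphic_resolvent:
  assumes "\<And>u. u \<in> S \<Longrightarrow> norm (u - u0) * \<rho> < 1"
  shows "holomorphic_fun_on (\<lambda>u. resolvent (u - u0) k) S"
  unfolding holomorphic_fun_on_def
proof (intro ballI exI conjI)
  fix u assume "u \<in> S"
  then have v: "norm (u - u0) * \<rho> < 1" by (rule assms)
  let ?D = "\<lambda>h. resolvent (u - u0) (T h (resolvent (u - u0) k))"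
  show "clinear ?D" by (rule clinear_compose[OF clinear_left clinear_resolvent[OF v]])
  have "((\<lambda>u. u - u0) has_derivative (\<lambda>h. h)) (at u)"
    by (auto intro!: derivative_eq_intros)
  from has_derivative_compose[OF this has_derivative_resolvent[OF v]]
  show "((\<lambda>u. resolvent (u - u0) k) has_derivative ?D) (at u)" .
qed

text \<open>The fibre at \<open>u\<close> is the image of the span of \<open>B\<close> under the
  resolvent at \<open>u - u0\<close>, an injective linear map whose values depend holomorphically on
  \<open>u\<close>. So a basis of that span yields one frame over the whole base, of constant
  rank.\<close>

lemma bundle_of_perturbed_kernels:
  assumes opn: "open (base E)" and small: "\<And>u. u \<in> base E \<Longrightarrow> norm (u - u0) * \<rho> < 1"
    and fib: "\<And>u. u \<in> base E \<Longrightarrow> fibre E u = {f. f - T (u - u0) f \<in> complex_vector.span B}"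
    and "finite B"
  shows "hermitian_holomorphic_bundle E"
proof -
  \<comment> \<open>\<open>B\<close> may be dependent; a frame needs a basis of its span.\<close>
  obtain B' where B': "B' \<subseteq> B" "complex_vector.independent B'" "B \<subseteq> complex_vector.span B'"
    using complex_vector.maximal_independent_subset by blast
  have span: "complex_vector.span B' = complex_vector.span B"
    using B' by (metis complex_vector.span_eq complex_vector.span_superset subset_trans)
  have "finite B'" using B' \<open>finite B\<close> finite_subset by blast
  then obtain \<kappa> where \<kappa>: "bij_betw \<kappa> {..<card B'} B'"
    using ex_bij_betw_nat_finite[of B'] by (auto simp: lessThan_atLeast0)
  define s where "s i u = resolvent (u - u0) (\<kappa> i)" for i u
  have frame: "inj_on (\<lambda>i. s i u) {..<card B'} \<and>
      complex_vector.independent ((\<lambda>i. s i u) ` {..<card B'}) \<and>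
      complex_vector.span ((\<lambda>i. s i u) ` {..<card B'}) = fibre E u" if u: "u \<in> base E" for u
  proof -
    let ?G = "resolvent (u - u0)"
    note v = small[OF u]
    interpret G: Vector_Spaces.linear scaleC scaleC ?G by (rule clinear_resolvent[OF v])
    have inj: "inj ?G"
    proof (rule injI)
      fix x y assume "?G x = ?G y"
      then show "x = y" using resolvent_eq[OF v, of x] resolvent_eq[OF v, of y] by (metis add_left_cancel)
    qed
    have "(\<lambda>i. s i u) ` {..<card B'} = ?G ` \<kappa> ` {..<card B'}"
      by (simp add: s_def image_image)
    then have img: "(\<lambda>i. s i u) ` {..<card B'} = ?G ` B'"
      by (simp only: bij_betw_imp_surj_on[OF \<kappa>])
    have "f \<in> ?G ` complex_vector.span B \<longleftrightarrow> f - T (u - u0) f \<in> complex_vector.span B" for f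
    proof
      assume "f \<in> ?G ` complex_vector.span B"
      then obtain k where k: "k \<in> complex_vector.span B" "f = ?G k" by blast
      then have "f - T (u - u0) f = k" using resolvent_eq[OF v, of k] by (simp add: algebra_simps)
      then show "f - T (u - u0) f \<in> complex_vector.span B" using k by simp
    next
      assume *: "f - T (u - u0) f \<in> complex_vector.span B"
      have "f = ?G (f - T (u - u0) f)" by (rule resolventI[OF v]) simp
      then show "f \<in> ?G ` complex_vector.span B" using * by blast
    qed
    then have "complex_vector.span (?G ` B') = fibre E u"
      by (auto simp: G.span_image span fib[OF u])
    moreover have "inj_on (\<lambda>i. s i u) {..<card B'}"
      unfolding s_def using comp_inj_on[OF bij_betw_imp_inj_on[OF \<kappa>] inj_on_subset[OF inj subset_UNIV]]
      by (simp add: o_def)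
    ultimately show ?thesis
      using G.independent_injective_image[OF B'(2) inj_on_subset[OF inj subset_UNIV]]
      by (simp add: img)
  qed
  have "holomorphic_frame E (base E) (card B') s"
    unfolding holomorphic_frame_def holomorphic_section_def
  proof (intro conjI allI impI ballI)
    fix i assume i: "i < card B'"
    show "holomorphic_fun_on (s i) (base E)"
      unfolding s_def by (rule holomorphic_resolvent[OF small])
    fix u assume u: "u \<in> base E"
    have "s i u \<in> (\<lambda>i. s i u) ` {..<card B'}" using i by simp
    then have "s i u \<in> complex_vector.span ((\<lambda>i. s i u) ` {..<card B'})"
      by (rule complex_vector.span_base)
    then show "s i u \<in> fibre E u" using frame[OF u] by simp
  qed (simp_all add: frame)
  then show ?thesis
    unfolding hermitian_holomorphic_bundle_def using opn by blast
qed

end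

section \<open>The operators of a Hilbert module\<close>

lemma clinear_vec_lambda:
  assumes "\<And>j. clinear (F j)"
  shows "clinear (\<lambda>x. \<chi> j. F j x)"
  by (rule clinearI) (simp_all add: vec_eq_iff scaleC_vec_def clinear_add[OF assms] clinear_scaleC[OF assms])

lemma cnj_vec_cnj_vec [simp]: "cnj_vec (cnj_vec w) = w"
  by (simp add: cnj_vec_def vec_eq_iff)

lemma norm_cnj_vec [simp]: "norm (cnj_vec w) = norm w"
  by (simp add: cnj_vec_def norm_vec_def)

lemma cnj_vec_diff: "cnj_vec (v - w) = cnj_vec v - cnj_vec w"
  by (simp add: cnj_vec_def vec_eq_iff)

lemma continuous_on_cnj_vec: "continuous_on S cnj_vec"
  unfolding cnj_vec_def by (intro continuous_intros)

lemma image_cnj_vec: "cnj_vec ` S = {u. cnj_vec u \<in> S}"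
  by (force simp: image_iff)

locale B1_module =
  fixes \<Omega> :: "(complex ^ 'm) set" and ev :: "'h::complex_hilbert \<Rightarrow> complex ^ 'm \<Rightarrow> complex"
  assumes class_B1: "class_B1 \<Omega> ev"
begin

section \<open>Evaluation of elements and the action of polynomials\<close>

lemma ev_eqI: "(\<And>z. z \<in> \<Omega> \<Longrightarrow> ev f z = ev g z) \<Longrightarrow> f = g"
  using class_B1 by (simp add: class_B1_def function_space_def)

lemma ev_add: "z \<in> \<Omega> \<Longrightarrow> ev (f + g) z = ev f z + ev g z"
  and ev_scaleC: "z \<in> \<Omega> \<Longrightarrow> ev (c *\<^sub>C f) z = c * ev f z"
  using class_B1 by (simp_all add: class_B1_def function_space_def)

lemma ev_diff: "z \<in> \<Omega> \<Longrightarrow> ev (f - g) z = ev f z - ev g z"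
  using ev_add[of z "f - g" g] by simp

lemma act_eqI: "(\<And>z. z \<in> \<Omega> \<Longrightarrow> ev g z = p z * ev f z) \<Longrightarrow> act \<Omega> ev p f = g"
  unfolding act_def by (rule the_equality) (auto intro: ev_eqI)

lemma ev_act:
  assumes "poly_fun p" "z \<in> \<Omega>"
  shows "ev (act \<Omega> ev p f) z = p z * ev f z"
proof -
  have "\<exists>g. \<forall>z\<in>\<Omega>. ev g z = p z * ev f z"
    using class_B1 assms(1) by (simp add: class_B1_def)
  then obtain g where g: "\<forall>z\<in>\<Omega>. ev g z = p z * ev f z" by blast
  then have "act \<Omega> ev p f = g" by (intro act_eqI) blast
  then show ?thesis using g assms(2) by simp
qed

lemma clinear_act: "poly_fun p \<Longrightarrow> clinear (act \<Omega> ev p)"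
  and bounded_act: "poly_fun p \<Longrightarrow> bounded_linear (act \<Omega> ev p)"
  using class_B1 by (simp_all add: class_B1_def)

lemma poly_fun_coord_diff: "poly_fun (\<lambda>z. z $ j - c)"
  using poly_fun.add[OF poly_fun.coord poly_fun.const[of "- c"]] by simp

text \<open>As the action of a polynomial, the shifted multiplication inherits linearity and
  boundedness from \<open>class_B1\<close>, and it is linked to the maximal ideal.\<close>

lemma coord_mult_diff: "coord_mult \<Omega> ev j g - c *\<^sub>C g = act \<Omega> ev (\<lambda>z. z $ j - c) g"
proof (rule act_eqI[symmetric])
  fix z assume z: "z \<in> \<Omega>"
  show "ev (coord_mult \<Omega> ev j g - c *\<^sub>C g) z = (z $ j - c) * ev g z"
    by (simp add: ev_diff[OF z] ev_scaleC[OF z] coord_mult_def ev_act[OF poly_fun.coord z]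
        left_diff_distrib)
qed

lemma clinear_coord_mult_diff: "clinear (\<lambda>g. coord_mult \<Omega> ev j g - c *\<^sub>C g)"
  and bounded_coord_mult_diff: "bounded_linear (\<lambda>g. coord_mult \<Omega> ev j g - c *\<^sub>C g)"
  unfolding coord_mult_diff
  by (rule clinear_act[OF poly_fun_coord_diff], rule bounded_act[OF poly_fun_coord_diff])

section \<open>The tuple of adjoints and its closed range\<close>

lemma cinner_D_adj:
  "cinner (coord_mult \<Omega> ev j g - (w $ j) *\<^sub>C g) f = cinner g (D_adj \<Omega> ev w f $ j)"
  unfolding D_adj_def
  using cinner_hilbert_adjoint[OF clinear_coord_mult_diff bounded_coord_mult_diff] by simp

lemma clinear_D_adj: "clinear (D_adj \<Omega> ev w)"
proof -
  have "clinear (\<lambda>f. \<chi> j. D_adj \<Omega> ev w f $ j)"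
    by (rule clinear_vec_lambda, rule clinear_adjoint, rule cinner_D_adj)
  then show ?thesis by simp
qed

lemma bounded_D_adj: "bounded_linear (D_adj \<Omega> ev w)"
proof -
  define B where "B j = onorm (\<lambda>g. coord_mult \<Omega> ev j g - (w $ j) *\<^sub>C g)" for j
  have "norm (D_adj \<Omega> ev w f $ j) \<le> B j * norm f" for f j
    by (rule norm_adjoint_le[OF cinner_D_adj])
      (simp_all add: B_def onorm[OF bounded_coord_mult_diff] onorm_pos_le[OF bounded_coord_mult_diff])
  then have "norm (D_adj \<Omega> ev w f) \<le> (\<Sum>j\<in>UNIV. B j) * norm f" for f
    unfolding norm_vec_def sum_distrib_right
    by (intro order_trans[OF L2_set_le_sum] sum_mono) auto
  then show ?thesis by (rule clinear_bounded[OF clinear_D_adj])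
qed

text \<open>The adjoint of the scalar \<open>w_j\<close> is its conjugate, so the tuple is affine in
  the conjugate of \<open>w\<close>; hence the bundle lives over the conjugated domain.\<close>

lemma D_adj_shift:
  "D_adj \<Omega> ev w f = D_adj \<Omega> ev w0 f - (\<chi> j. (cnj_vec w - cnj_vec w0) $ j *\<^sub>C f)"
proof (subst vec_eq_iff, rule allI, rule cinner_eqI)
  fix j g
  show "cinner g (D_adj \<Omega> ev w f $ j)
      = cinner g ((D_adj \<Omega> ev w0 f - (\<chi> j. (cnj_vec w - cnj_vec w0) $ j *\<^sub>C f)) $ j)"
    by (simp only: cinner_diff_right cinner_scaleC_right vector_minus_component vec_lambda_beta
        cinner_D_adj[symmetric] cinner_diff_left cinner_scaleC_left)
      (simp add: cnj_vec_def left_diff_distrib)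
qed

text \<open>The row operator on the left, whose range is
  \<open>maximal_ideal_module \<Omega> ev w\<close>, has \<open>D_adj \<Omega> ev w\<close> as its
  adjoint; it takes the place of \<open>A\<close> in the abstract estimates.\<close>

lemma cinner_D_adj_vec:
  "cinner (\<Sum>j\<in>UNIV. act \<Omega> ev (\<lambda>z. z $ j - w $ j) (h $ j)) f = cinner h (D_adj \<Omega> ev w f)"
  by (simp add: cinner_vec_def cinner_sum_left flip: coord_mult_diff cinner_D_adj)

lemma maximal_ideal_module_eq_range:
  "maximal_ideal_module \<Omega> ev w
    = range (\<lambda>h. \<Sum>j\<in>UNIV. act \<Omega> ev (\<lambda>z. z $ j - w $ j) (h $ j))"
proof -
  have "(\<Sum>j\<in>UNIV. act \<Omega> ev (\<lambda>z. z $ j - w $ j) (f j))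
      = (\<Sum>j\<in>UNIV. act \<Omega> ev (\<lambda>z. z $ j - w $ j) ((\<chi> j. f j) $ j))" for f
    by simp
  then show ?thesis unfolding maximal_ideal_module_def by blast
qed

lemma spanning_complement:
  assumes "w \<in> \<Omega>"
  obtains B where "finite B" "complex_vector.span (B \<union>
    range (\<lambda>h. \<Sum>j\<in>UNIV. act \<Omega> ev (\<lambda>z. z $ j - w $ j) (h $ j))) = UNIV"
  using class_B1 assms
  unfolding class_B1_def finite_codim_def maximal_ideal_module_eq_range by blast

text \<open>Finite codimension of the maximal ideal module gives the lower bound up to finitely many
  functionals, which are then removed on the complement of the kernel.\<close>

lemma closed_range_D_adj:
  assumes "w \<in> \<Omega>"
  shows "closed_range_operator (D_adj \<Omega> ev w)"
proof (rule closed_range_operator.intro[OF clinear_D_adj bounded_D_adj])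
  obtain B where B: "finite B" "complex_vector.span (B \<union>
    range (\<lambda>h. \<Sum>j\<in>UNIV. act \<Omega> ev (\<lambda>z. z $ j - w $ j) (h $ j))) = UNIV"
    using spanning_complement[OF assms] by blast
  from bounded_below_modulo_finite[OF clinear_D_adj cinner_D_adj_vec B]
  obtain C where C: "C > 0"
    "\<And>f. norm f \<le> C * (norm (D_adj \<Omega> ev w f) + (\<Sum>b\<in>B. cmod (cinner f b)))" by blast
  show "\<exists>C>0. \<forall>f\<in>orth (ker (D_adj \<Omega> ev w)). norm f \<le> C * norm (D_adj \<Omega> ev w f)"
    by (rule bounded_below_on_orth_ker[OF clinear_D_adj bounded_D_adj B(1) C])
qed

lemma finite_dim_ker_D_adj:
  assumes "w \<in> \<Omega>"
  obtains B where "finite B" "ker (D_adj \<Omega> ev w) = complex_vector.span B"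
proof -
  obtain B where B: "finite B" "complex_vector.span (B \<union>
    range (\<lambda>h. \<Sum>j\<in>UNIV. act \<Omega> ev (\<lambda>z. z $ j - w $ j) (h $ j))) = UNIV"
    using spanning_complement[OF assms] by blast
  show ?thesis
    by (rule that[OF finite_imageI[OF B(1)]
          ker_eq_span_projection[OF clinear_D_adj bounded_D_adj cinner_D_adj_vec B(2)]])
qed

lemma fibre_P0_bundle:
  assumes "w0 \<in> \<Omega>"
  shows "fibre (P0_bundle \<Omega> ev w0) u
    = {f. D_adj \<Omega> ev (cnj_vec u) f \<in> orth (range (D_adj \<Omega> ev w0))}"
  by (simp add: P0_bundle_def ker_def
      closed_range_operator.orth_proj_range_eq_0_iff[OF closed_range_D_adj[OF assms]])

lemma base_P0_bundle:
  "base (P0_bundle \<Omega> ev w0) = {u. cnj_vec u \<in> \<Omega> \<and>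
    norm (u - cnj_vec w0) * onorm (moore_penrose (D_adj \<Omega> ev w0)) < 1}"
proof -
  have "norm (cnj_vec u - w0) = norm (u - cnj_vec w0)" for u
    using norm_cnj_vec[of "u - cnj_vec w0"] by (simp add: cnj_vec_diff)
  then show ?thesis by (simp add: P0_bundle_def image_cnj_vec Omega0_def)
qed

lemma hermitian_holomorphic_P0_bundle:
  assumes "open \<Omega>" and w0: "w0 \<in> \<Omega>"
  shows "hermitian_holomorphic_bundle (P0_bundle \<Omega> ev w0)"
proof -
  define R where "R = moore_penrose (D_adj \<Omega> ev w0)"
  define T where "T v f = R (\<chi> j. v $ j *\<^sub>C f)" for v f
  interpret D: closed_range_operator "D_adj \<Omega> ev w0" by (rule closed_range_D_adj[OF w0])
  have R: "clinear R" "bounded_linear R"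
    unfolding R_def by (rule D.clinear_moore_penrose D.bounded_moore_penrose)+
  interpret bounded_bilinear_action T "onorm R"
  proof (rule bounded_bilinear_action.intro)
    fix v f
    show "clinear (\<lambda>v. T v f)" unfolding T_def
      by (rule clinear_compose[OF _ R(1)], rule clinear_vec_lambda, rule clinearI)
        (simp_all add: scaleC_add_left scaleC_scaleC scaleC_vec_def scaleC_complex_def)
    show "clinear (T v)" unfolding T_def
      by (rule clinear_compose[OF _ R(1)], rule clinear_vec_lambda, rule clinearI)
        (simp_all add: scaleC_add_right scaleC_scaleC mult.commute)
    show "norm (T v f) \<le> norm v * onorm R * norm f"
      using onorm[OF R(2), of "\<chi> j. v $ j *\<^sub>C f"] by (simp add: T_def norm_scaleC_vec mult_ac)
    show "0 \<le> onorm R" by (rule onorm_pos_le[OF R(2)])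
  qed
  obtain B where B: "finite B" "ker (D_adj \<Omega> ev w0) = complex_vector.span B"
    using finite_dim_ker_D_adj[OF w0] .
  show ?thesis
  proof (rule bundle_of_perturbed_kernels[OF _ _ _ B(1)])
    have "open {u. cnj_vec u \<in> \<Omega>}"
      using open_vimage[OF assms(1) continuous_on_cnj_vec] by (simp add: vimage_def)
    moreover have "open {u. norm (u - cnj_vec w0) * onorm R < 1}"
      by (intro open_Collect_less continuous_intros)
    ultimately show "open (base (P0_bundle \<Omega> ev w0))"
      unfolding base_P0_bundle R_def[symmetric] by (rule open_Collect_conj)
    show "norm (u - cnj_vec w0) * onorm R < 1" if "u \<in> base (P0_bundle \<Omega> ev w0)" for u
      using that by (simp add: base_P0_bundle R_def)
    show "fibre (P0_bundle \<Omega> ev w0) u = {f. f - T (u - cnj_vec w0) f \<in> complex_vector.span B}" for u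
    proof -
      have "D_adj \<Omega> ev (cnj_vec u) f \<in> orth (range (D_adj \<Omega> ev w0))
          \<longleftrightarrow> f - T (u - cnj_vec w0) f \<in> ker (D_adj \<Omega> ev w0)" for f
        unfolding D_adj_shift[of "cnj_vec u" f w0] D.diff_orth_range_iff
        by (simp add: T_def R_def)
      then show ?thesis by (simp add: fibre_P0_bundle[OF w0] B(2))
    qed
  qed
qed

end

section \<open>Transport along a unitary module map\<close>

locale unitary_equivalent_modules =
  M: B1_module \<Omega> ev + M': B1_module \<Omega> ev'
  for \<Omega> :: "(complex ^ 'm) set"
    and ev :: "'h::complex_hilbert \<Rightarrow> complex ^ 'm \<Rightarrow> complex"
    and ev' :: "'k::complex_hilbert \<Rightarrow> complex ^ 'm \<Rightarrow> complex" +
  fixes U :: "'h \<Rightarrow> 'k"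
  assumes unitary: "unitary_module_map \<Omega> ev ev' U"
begin

section \<open>Elementary properties of \<open>U\<close> and of its inverse\<close>

lemma clinear_U: "clinear U" and surj_U: "surj U"
  and cinner_U: "cinner (U f) (U g) = cinner f g"
  and U_act: "poly_fun p \<Longrightarrow> U (act \<Omega> ev p f) = act \<Omega> ev' p (U f)"
  using unitary by (simp_all add: unitary_module_map_def)

lemma norm_U: "norm (U f) = norm f"
  using cinner_U[of f f] by (simp add: cinner_self flip: of_real_power)

lemma inj_U: "inj U"
proof (rule injI)
  fix f g assume "U f = U g"
  then have "norm (f - g) = 0"
    using norm_U[of "f - g"] by (simp add: clinear_diff[OF clinear_U])
  then show "f = g" by simp
qed

lemma inv_U [simp]: "inv U (U f) = f" and U_inv [simp]: "U (inv U y) = y"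
  by (simp_all add: inj_U surj_U surj_f_inv_f)

lemma unitary_inv: "unitary_module_map \<Omega> ev' ev (inv U)"
  unfolding unitary_module_map_def
proof (intro conjI allI impI)
  show "clinear (inv U)"
    by (rule clinearI; rule injD[OF inj_U])
      (simp_all add: clinear_add[OF clinear_U] clinear_scaleC[OF clinear_U])
  show "surj (inv U)" by (rule surjI[of _ U]) simp
  show "cinner (inv U f) (inv U g) = cinner f g" for f g
    by (simp flip: cinner_U)
  show "inv U (act \<Omega> ev' p f) = act \<Omega> ev p (inv U f)" if "poly_fun p" for p f
    by (rule injD[OF inj_U]) (simp add: U_act[OF that])
qed

lemma bounded_U: "bounded_linear U"
  by (rule clinear_bounded[OF clinear_U, where B = 1]) (simp add: norm_U)

text \<open>\<open>U\<close> intertwines the multiplications and, being unitary, also their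
  adjoints; the test vector \<open>y\<close> is written as \<open>U\<close> of its preimage.\<close>

lemma D_adj_U: "D_adj \<Omega> ev' w (U f) $ j = U (D_adj \<Omega> ev w f $ j)"
proof (rule cinner_eqI)
  fix y
  have "cinner (U (inv U y)) (D_adj \<Omega> ev' w (U f) $ j)
      = cinner (U (coord_mult \<Omega> ev j (inv U y) - (w $ j) *\<^sub>C inv U y)) (U f)"
    by (simp add: clinear_diff[OF clinear_U] clinear_scaleC[OF clinear_U]
        coord_mult_def U_act[OF poly_fun.coord] flip: M'.cinner_D_adj)
  also have "\<dots> = cinner (U (inv U y)) (U (D_adj \<Omega> ev w f $ j))"
    by (simp only: cinner_U M.cinner_D_adj)
  finally show "cinner y (D_adj \<Omega> ev' w (U f) $ j) = cinner y (U (D_adj \<Omega> ev w f $ j))"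
    by simp
qed

lemma cinner_D_adj_U: "cinner (D_adj \<Omega> ev' w (U f)) (D_adj \<Omega> ev' v (U g))
    = cinner (D_adj \<Omega> ev w f) (D_adj \<Omega> ev v g)"
  by (simp add: cinner_vec_def D_adj_U cinner_U)

lemma fibre_U:
  assumes "w0 \<in> \<Omega>"
  shows "U f \<in> fibre (P0_bundle \<Omega> ev' w0) u \<longleftrightarrow> f \<in> fibre (P0_bundle \<Omega> ev w0) u"
proof -
  \<comment> \<open>Since \<open>U\<close> is onto, orthogonality to the range at \<open>w0\<close>
    need only be tested on vectors \<open>U g\<close>, where inner products agree with those of the
    first module.\<close>
  have "(\<forall>y. cinner (D_adj \<Omega> ev' (cnj_vec u) (U f)) (D_adj \<Omega> ev' w0 y) = 0)
      \<longleftrightarrow> (\<forall>g. cinner (D_adj \<Omega> ev' (cnj_vec u) (U f)) (D_adj \<Omega> ev' w0 (U g)) = 0)"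
    by (metis U_inv)
  then show ?thesis
    by (simp add: M.fibre_P0_bundle[OF assms] M'.fibre_P0_bundle[OF assms] orth_def cinner_D_adj_U)
qed

text \<open>With \<open>V\<close> the componentwise inverse of \<open>U\<close>, uniqueness
  identifies the Moore-Penrose inverse for the second module as \<open>U R V\<close>, and
  \<open>U\<close> and \<open>V\<close> preserve norms. Exchanging the modules gives the reverse
  inequality.\<close>

lemma onorm_moore_penrose_le:
  assumes w0: "w0 \<in> \<Omega>"
  shows "onorm (moore_penrose (D_adj \<Omega> ev' w0)) \<le> onorm (moore_penrose (D_adj \<Omega> ev w0))"
proof -
  define R where "R = moore_penrose (D_adj \<Omega> ev w0)"
  define V where "V y = (\<chi> j. inv U (y $ j))" for y :: "'k ^ 'm"
  interpret D: closed_range_operator "D_adj \<Omega> ev w0" by (rule M.closed_range_D_adj[OF w0])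
  interpret D': closed_range_operator "D_adj \<Omega> ev' w0" by (rule M'.closed_range_D_adj[OF w0])
  have clin_inv: "clinear (inv U)" and cinner_inv: "\<And>x y. cinner (inv U x) (inv U y) = cinner x y"
    using unitary_inv by (simp_all add: unitary_module_map_def)
  have clin_comp: "clinear (\<lambda>y :: 'k ^ 'm. inv U (y $ j))" for j
    by (rule clinearI) (simp_all add: clinear_add[OF clin_inv] clinear_scaleC[OF clin_inv] scaleC_vec_def)
  have V: "clinear V" unfolding V_def by (rule clinear_vec_lambda[OF clin_comp])
  have cinner_V: "cinner (V x) (V y) = cinner x y" for x y
    by (simp add: V_def cinner_vec_def cinner_inv)
  have V_D: "V (D_adj \<Omega> ev' w0 (U f)) = D_adj \<Omega> ev w0 f" for f
    by (simp add: V_def D_adj_U vec_eq_iff)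
  have norm_V: "norm (V y) = norm y" for y
    using cinner_V[of y y] by (simp add: cinner_self flip: of_real_power)
  have mp: "moore_penrose (D_adj \<Omega> ev' w0) = (\<lambda>y. U (R (V y)))"
  proof (rule D'.moore_penrose_eqI)
    show "clinear (\<lambda>y. U (R (V y)))"
      unfolding R_def
      by (rule clinear_compose[OF clinear_compose[OF V D.clinear_moore_penrose] clinear_U])
    fix y assume y: "y \<in> orth (range (D_adj \<Omega> ev' w0))"
    have "cinner (V y) (D_adj \<Omega> ev w0 g) = 0" for g
      unfolding V_D[symmetric] cinner_V using y by (simp add: orth_def)
    then have "V y \<in> orth (range (D_adj \<Omega> ev w0))" by (auto simp: orth_def)
    then have "R (V y) = 0" unfolding R_def by (rule D.moore_penrose_eq_0)
    then show "U (R (V y)) = 0" using norm_U[of 0] by simp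
  next
    fix x assume x: "x \<in> orth (ker (D_adj \<Omega> ev' w0))"
    \<comment> \<open>\<open>U\<close> maps the first kernel into the second, so
      \<open>inv U\<close> maps the orthogonal complement of the second into that of the
      first.\<close>
    have "D_adj \<Omega> ev' w0 (U f) = 0" if "D_adj \<Omega> ev w0 f = 0" for f
      using norm_V[of "D_adj \<Omega> ev' w0 (U f)"] that by (simp add: V_D)
    then have "cinner (inv U x) f = 0" if "D_adj \<Omega> ev w0 f = 0" for f
      using x that cinner_U[of "inv U x" f] by (simp add: orth_def ker_def)
    then have "inv U x \<in> orth (ker (D_adj \<Omega> ev w0))" by (simp add: orth_def ker_def)
    then have "R (D_adj \<Omega> ev w0 (inv U x)) = inv U x" unfolding R_def by (rule D.moore_penrose_D)
    then show "U (R (V (D_adj \<Omega> ev' w0 x))) = x"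
      using V_D[of "inv U x"] by simp
  qed
  have "norm (U (R (V y))) \<le> onorm R * norm y" for y
    using onorm[OF D.bounded_moore_penrose, of "V y"] by (simp add: norm_U norm_V R_def)
  moreover have "0 \<le> onorm R"
    unfolding R_def by (rule onorm_pos_le[OF D.bounded_moore_penrose])
  ultimately show ?thesis unfolding mp R_def[symmetric] by (intro onorm_bound)
qed

text \<open>Composition with a fixed bounded complex linear map preserves complex differentiability,
  and \<open>U\<close> preserves the fibre condition.\<close>

lemma holomorphic_bundle_map_U:
  assumes w0: "w0 \<in> \<Omega>"
  shows "holomorphic_bundle_map (P0_bundle \<Omega> ev w0) (P0_bundle \<Omega> ev' w0) (\<lambda>_. U)"
  unfolding holomorphic_bundle_map_def
proof (intro conjI ballI allI impI)
  show "U ` fibre (P0_bundle \<Omega> ev w0) u \<subseteq> fibre (P0_bundle \<Omega> ev' w0) u" for u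
    by (auto simp: fibre_U[OF w0])
  show "U (a *\<^sub>C f + b *\<^sub>C g) = a *\<^sub>C U f + b *\<^sub>C U g" for a b f g
    by (simp add: clinear_add[OF clinear_U] clinear_scaleC[OF clinear_U])
  fix V s
  assume "open V \<and> V \<subseteq> base (P0_bundle \<Omega> ev w0) \<and> holomorphic_section (P0_bundle \<Omega> ev w0) V s"
  then have s: "holomorphic_fun_on s V" "\<And>x. x \<in> V \<Longrightarrow> s x \<in> fibre (P0_bundle \<Omega> ev w0) x"
    by (simp_all add: holomorphic_section_def)
  have "holomorphic_fun_on (\<lambda>x. U (s x)) V"
    unfolding holomorphic_fun_on_def
  proof
    fix x assume "x \<in> V"
    then obtain D where D: "clinear D" "(s has_derivative D) (at x)"
      using s(1) unfolding holomorphic_fun_on_def by blast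
    show "\<exists>D. clinear D \<and> ((\<lambda>x. U (s x)) has_derivative D) (at x)"
      using clinear_compose[OF D(1) clinear_U] bounded_linear.has_derivative[OF bounded_U D(2)]
      by blast
  qed
  then show "holomorphic_section (P0_bundle \<Omega> ev' w0) V (\<lambda>x. U (s x))"
    by (simp add: holomorphic_section_def fibre_U[OF w0] s(2))
qed

end

theorem theorem1p10:
  fixes \<Omega> :: "(complex ^ 'm) set"
    and ev :: "'h::complex_hilbert \<Rightarrow> complex ^ 'm \<Rightarrow> complex"
    and ev' :: "'k::complex_hilbert \<Rightarrow> complex ^ 'm \<Rightarrow> complex"
    and w0 :: "complex ^ 'm"
  assumes "bounded_domain \<Omega>"
    and "class_B1 \<Omega> ev"
    and "class_B1 \<Omega> ev'"
    and "\<exists>U. unitary_module_map \<Omega> ev ev' U"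
    and "w0 \<in> \<Omega>"
  shows "equivalent_bundles (P0_bundle \<Omega> ev w0) (P0_bundle \<Omega> ev' w0)"
proof -
  have opn: "open \<Omega>" using assms(1) by (simp add: bounded_domain_def)
  obtain U where U: "unitary_module_map \<Omega> ev ev' U" using assms(4) by blast
  interpret U: unitary_equivalent_modules \<Omega> ev ev' U
    by (simp add: unitary_equivalent_modules_def B1_module_def
        unitary_equivalent_modules_axioms_def assms U)
  \<comment> \<open>The same facts for \<open>inv U\<close> give the reverse norm inequality and the
    inverse bundle map.\<close>
  interpret W: unitary_equivalent_modules \<Omega> ev' ev "inv U"
    by (simp add: unitary_equivalent_modules_def B1_module_def
        unitary_equivalent_modules_axioms_def assms U.unitary_inv)
  have "onorm (moore_penrose (D_adj \<Omega> ev' w0)) = onorm (moore_penrose (D_adj \<Omega> ev w0))"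
    using U.onorm_moore_penrose_le[OF assms(5)] W.onorm_moore_penrose_le[OF assms(5)]
    by (rule antisym)
  then have base: "base (P0_bundle \<Omega> ev w0) = base (P0_bundle \<Omega> ev' w0)"
    by (simp add: U.M.base_P0_bundle U.M'.base_P0_bundle)
  show ?thesis
    unfolding equivalent_bundles_def
  proof (intro conjI exI ballI)
    show "hermitian_holomorphic_bundle (P0_bundle \<Omega> ev w0)"
      by (rule U.M.hermitian_holomorphic_P0_bundle[OF opn assms(5)])
    show "hermitian_holomorphic_bundle (P0_bundle \<Omega> ev' w0)"
      by (rule U.M'.hermitian_holomorphic_P0_bundle[OF opn assms(5)])
    show "holomorphic_bundle_map (P0_bundle \<Omega> ev w0) (P0_bundle \<Omega> ev' w0) (\<lambda>_. U)"
      by (rule U.holomorphic_bundle_map_U[OF assms(5)])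
    show "holomorphic_bundle_map (P0_bundle \<Omega> ev' w0) (P0_bundle \<Omega> ev w0) (\<lambda>_. inv U)"
      by (rule W.holomorphic_bundle_map_U[OF assms(5)])
  qed (simp_all add: base U.cinner_U)
qed

end
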